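(* Let $(V_k,V_k^+,e_k)_{k\in\mathbb{N}}$ be Archimedean order unit (AOU) spaces and let $\phi_k:V_k\to V_{k+1}$ be unital positive linear maps, so that $V_1\xrightarrow{\phi_1}V_2\xrightarrow{\phi_2}V_3\xrightarrow{\phi_3}\cdots$ is an inductive system in the category $\mathbf{AOU}$. Let $(V_\infty,V_\infty^+,e_\infty)$ and $\phi_{k,\infty}:V_k\to V_\infty$, $k\in\mathbb{N}$, be as constructed in the context. Then $(V_\infty,V_\infty^+,e_\infty)$, together with $\{\phi_{k,\infty}\}_{k\in\mathbb{N}}$, is the inductive limit of this inductive system in $\mathbf{AOU}$.
   Context: A $*$-vector space is a complex vector space $V$ with a conjugate-linear involution; $V_h=\{x:x^*=x\}$. An ordered $*$-vector space is $(V,V^+)$ with $V^+\subseteq V_h$ a cone and $V^+\cap(-V^+)=\{0\}$. An order unit is $e\in V^+$ such that for every $x\in V_h$ there is $r>0$ with $re-x\in V^+$; it is Archimedean if $V^+=\{x\in V_h:re+x\in V^+\ \forall r>0\}$. An AOU space is an ordered $*$-vector space with an Archimedean order unit. $\mathbf{AOU}$ has AOU spaces as objects and unital positive linear maps as morphisms. A state is a unital positive linear functional; $S(V)$ is the set of states. Inductive limit in a category: for a system $(\{A_k\},\{\alpha_k:A_k\to A_{k+1}\})$, an object $A$ with morphisms $\alpha_{k,\infty}:A_k\to A$ such that $\alpha_{k+1,\infty}\circ\alpha_k=\alpha_{k,\infty}$ and, whenever $\beta_k:A_k\to B$ are morphisms with $\beta_{k+1}\circ\alpha_k=\beta_k$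 for all $k$, there is a unique morphism $\mu:A\to B$ with $\mu\circ\alpha_{k,\infty}=\beta_k$ for all $k$. Construction. For $k<l$ put $\phi_{k,l}=\phi_{l-1}\circ\cdots\circ\phi_k$, and $\phi_{k,k}=\mathrm{id}$. Let $V_\infty^0=\{(x_k)_k\in\prod_kV_k:\exists m,\ \phi_k(x_k)=x_{k+1}\ \forall k\ge m\}$, $N^0=\{(x_k)_k\in V_\infty^0:\exists m,\ x_k=0\ \forall k\ge m\}$, $\ddot V_\infty=V_\infty^0/N^0$; let $\ddot\phi_{k,\infty}(x)$ be the class of the sequence $(y_i)$ with $y_i=0$ for $i<k$ and $y_i=\phi_{k,i}(x)$ for $i\ge k$. Then $\ddot V_\infty=\bigcup_k\ddot\phi_{k,\infty}(V_k)$ is an ordered $*$-vector space with involution $\ddot\phi_{k,\infty}(x)^*=\ddot\phi_{k,\infty}(x^* )$, cone $\ddot V_\infty^+=\{\ddot\phi_{k,\infty}(x_k):x_k\in V_k,\ \exists m\ge k,\ \phi_{k,m}(x_k)\in V_m^+\}$ and order unit $\ddot e_\infty=\ddot\phi_{k,\infty}(e_k)$ (independent of $k$). Let $N=\{x\in\ddot V_\infty:f(x)=0\ \forall f\in S(\ddot V_\infty)\}$ (the kernel of any order seminorm on $\ddot V_\infty$). Then $(V_\infty,V_\infty^+,e_\infty)$ is the Archimedeanisation of $\ddot V_\infty$: $V_\infty=\ddot V_\infty/N$ with $(x+N)^*=x^*+N$, $V_\infty^+=\{\ddot\phi_{k,\infty}(x_k)+N:k\in\mathbb{N},\ x_k\in(V_k)_h,\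 \ddot\phi_{k,\infty}(x_k)+r\ddot e_\infty\in\ddot V_\infty^+\ \forall r>0\}$, and $e_\infty=\ddot e_\infty+N$. Finally $\phi_{k,\infty}=q_V\circ\ddot\phi_{k,\infty}$, where $q_V:\ddot V_\infty\to V_\infty$ is the quotient map. *)

theory Defs
  imports
    Complex_Main
    "HOL-Library.FuncSet"
    "HOL-Library.Nonpos_Ints"
    "HOL-Algebra.Module"
    "HOL-Algebra.AbelCoset"
    "HOL-Algebra.Algebraic_Closure_Type"
begin

section \<open>AOU spaces\<close>

text \<open>
  Spaces are records with an explicit carrier, so that the members of a sequence of spaces may
  all differ. The fields \<open>mult\<close> and \<open>one\<close>, which the module record inherits from the ring
  record, carry no meaning.
\<close>

record 'a star_ou_space = "(complex, 'a) module" +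
  star :: "'a \<Rightarrow> 'a"
  pos :: "'a set"
  ounit :: 'a

definition hermitian :: "('a, 'm) star_ou_space_scheme \<Rightarrow> 'a set" where
  "hermitian V = {x \<in> carrier V. star V x = x}"

locale star_vector_space =
  module "ring_of_type_algebra :: complex ring" V
  for V :: "('a, 'm) star_ou_space_scheme" (structure) +
  assumes star_closed: "x \<in> carrier V \<Longrightarrow> star V x \<in> carrier V"
    and star_star: "x \<in> carrier V \<Longrightarrow> star V (star V x) = x"
    and star_add: "\<lbrakk>x \<in> carrier V; y \<in> carrier V\<rbrakk> \<Longrightarrow> star V (x \<oplus> y) = star V x \<oplus> star V y"
    and star_smult: "x \<in> carrier V \<Longrightarrow> star V (c \<odot> x) = cnj c \<odot> star V x"

locale ordered_star_vector_space = star_vector_space +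
  assumes pos_hermitian: "pos V \<subseteq> hermitian V"
    and pos_zero: "\<zero> \<in> pos V"
    and pos_add: "\<lbrakk>x \<in> pos V; y \<in> pos V\<rbrakk> \<Longrightarrow> x \<oplus> y \<in> pos V"
    and pos_smult: "\<lbrakk>0 \<le> r; x \<in> pos V\<rbrakk> \<Longrightarrow> complex_of_real r \<odot> x \<in> pos V"
    and pos_proper: "pos V \<inter> {\<ominus> x | x. x \<in> pos V} = {\<zero>}"

locale aou_space = ordered_star_vector_space +
  assumes ounit_pos: "ounit V \<in> pos V"
    and order_unit:
      "x \<in> hermitian V \<Longrightarrow> \<exists>r>0. complex_of_real r \<odot> ounit V \<ominus> x \<in> pos V"
    and archimedean:
      "pos V = {x \<in> hermitian V. \<forall>r>0. complex_of_real r \<odot> ounit V \<oplus> x \<in> pos V}"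

definition aou_hom ::
  "('a, 'm) star_ou_space_scheme \<Rightarrow> ('b, 'n) star_ou_space_scheme \<Rightarrow> ('a \<Rightarrow> 'b) \<Rightarrow> bool" where
  "aou_hom V W f \<longleftrightarrow>
     f \<in> carrier V \<rightarrow> carrier W \<and>
     (\<forall>x\<in>carrier V. \<forall>y\<in>carrier V. f (x \<oplus>\<^bsub>V\<^esub> y) = f x \<oplus>\<^bsub>W\<^esub> f y) \<and>
     (\<forall>c. \<forall>x\<in>carrier V. f (c \<odot>\<^bsub>V\<^esub> x) = c \<odot>\<^bsub>W\<^esub> f x) \<and>
     f ` pos V \<subseteq> pos W \<and>
     f (ounit V) = ounit W"

definition states :: "('a, 'm) star_ou_space_scheme \<Rightarrow> ('a \<Rightarrow> complex) set" where
  "states V = {f.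
     (\<forall>x\<in>carrier V. \<forall>y\<in>carrier V. f (x \<oplus>\<^bsub>V\<^esub> y) = f x + f y) \<and>
     (\<forall>c. \<forall>x\<in>carrier V. f (c \<odot>\<^bsub>V\<^esub> x) = c * f x) \<and>
     f ` pos V \<subseteq> \<real>\<^sub>\<ge>\<^sub>0 \<and>
     f (ounit V) = 1}"

section \<open>Inductive limits in the category of AOU spaces\<close>

text \<open>
  Morphisms are identified when they agree on the carrier of their domain; the mediating morphism
  is therefore taken to be extensional, which makes it unique as a function. A formula cannot
  quantify over types, so the element type \<open>'c\<close> of the competing objects is a parameter, and a
  theorem that holds for every \<open>'c\<close> expresses the full universal property.
\<close>

definition is_inductive_limit ::
  "'c itself \<Rightarrow> (nat \<Rightarrow> 'a star_ou_space) \<Rightarrow> (nat \<Rightarrow> 'a \<Rightarrow> 'a) \<Rightarrow>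
   'b star_ou_space \<Rightarrow> (nat \<Rightarrow> 'a \<Rightarrow> 'b) \<Rightarrow> bool" where
  "is_inductive_limit _ A \<alpha> L \<alpha>inf \<longleftrightarrow>
     aou_space L \<and>
     (\<forall>k. aou_hom (A k) L (\<alpha>inf k)) \<and>
     (\<forall>k. \<forall>x\<in>carrier (A k). \<alpha>inf (Suc k) (\<alpha> k x) = \<alpha>inf k x) \<and>
     (\<forall>(B :: 'c star_ou_space) \<beta>.
        aou_space B \<and>
        (\<forall>k. aou_hom (A k) B (\<beta> k)) \<and>
        (\<forall>k. \<forall>x\<in>carrier (A k). \<beta> (Suc k) (\<alpha> k x) = \<beta> k x) \<longrightarrow>
        (\<exists>!\<mu>. \<mu> \<in> extensional (carrier L) \<and> aou_hom L B \<mu> \<and>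
               (\<forall>k. \<forall>x\<in>carrier (A k). \<mu> (\<alpha>inf k x) = \<beta> k x)))"

section \<open>The construction\<close>

text \<open>
  The quotient of a complex vector space \<open>M\<close> by a subspace \<open>H\<close>, with prescribed involution, cone
  and unit. Scalar multiplication is the coset of \<open>c \<odot> x\<close> for any representative \<open>x\<close>; taking
  the image of \<open>C\<close> under \<open>x \<mapsto> c \<odot> x\<close> would be wrong for \<open>c = 0\<close>.
\<close>

definition quotient_space ::
  "((complex, 'a, 'm) module_scheme) \<Rightarrow> 'a set \<Rightarrow> ('a set \<Rightarrow> 'a set) \<Rightarrow> 'a set set \<Rightarrow> 'a set \<Rightarrow>
   'a set star_ou_space" where
  "quotient_space M H st P e =
     \<lparr>carrier = a_rcosets\<^bsub>M\<^esub> H, monoid.mult = undefined, one = undefined,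
      zero = H, add = set_add M,
      module.smult = (\<lambda>c C. \<Union>x\<in>C. H +>\<^bsub>M\<^esub> (c \<odot>\<^bsub>M\<^esub> x)),
      star = st, pos = P, ounit = e\<rparr>"

text \<open>\<open>phi_to \<phi> k l\<close> is \<open>\<phi> (l - 1) \<circ> \<dots> \<circ> \<phi> k\<close> for \<open>k < l\<close>, and the identity for \<open>k = l\<close>.\<close>

definition phi_to :: "(nat \<Rightarrow> 'a \<Rightarrow> 'a) \<Rightarrow> nat \<Rightarrow> nat \<Rightarrow> 'a \<Rightarrow> 'a" where
  "phi_to \<phi> k l = fold \<phi> [k..<l]"

definition seq_space ::
  "(nat \<Rightarrow> 'a star_ou_space) \<Rightarrow> (nat \<Rightarrow> 'a \<Rightarrow> 'a) \<Rightarrow> (complex, nat \<Rightarrow> 'a) module" where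
  "seq_space V \<phi> =
     \<lparr>carrier = {x \<in> (\<Pi> k\<in>UNIV. carrier (V k)). \<exists>m. \<forall>k\<ge>m. \<phi> k (x k) = x (Suc k)},
      monoid.mult = undefined, one = undefined,
      zero = (\<lambda>k. \<zero>\<^bsub>V k\<^esub>), add = (\<lambda>x y k. x k \<oplus>\<^bsub>V k\<^esub> y k),
      module.smult = (\<lambda>c x k. c \<odot>\<^bsub>V k\<^esub> x k)\<rparr>"

definition null_seqs ::
  "(nat \<Rightarrow> 'a star_ou_space) \<Rightarrow> (nat \<Rightarrow> 'a \<Rightarrow> 'a) \<Rightarrow> (nat \<Rightarrow> 'a) set" where
  "null_seqs V \<phi> = {x \<in> carrier (seq_space V \<phi>). \<exists>m. \<forall>k\<ge>m. x k = \<zero>\<^bsub>V k\<^esub>}"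

definition phi_ddot ::
  "(nat \<Rightarrow> 'a star_ou_space) \<Rightarrow> (nat \<Rightarrow> 'a \<Rightarrow> 'a) \<Rightarrow> nat \<Rightarrow> 'a \<Rightarrow> (nat \<Rightarrow> 'a) set" where
  "phi_ddot V \<phi> k x =
     null_seqs V \<phi> +>\<^bsub>seq_space V \<phi>\<^esub> (\<lambda>i. if i < k then \<zero>\<^bsub>V i\<^esub> else phi_to \<phi> k i x)"

text \<open>The order unit does not depend on the index; index \<open>0\<close> is used.\<close>

definition V_ddot ::
  "(nat \<Rightarrow> 'a star_ou_space) \<Rightarrow> (nat \<Rightarrow> 'a \<Rightarrow> 'a) \<Rightarrow> (nat \<Rightarrow> 'a) set star_ou_space" where
  "V_ddot V \<phi> =
     quotient_space (seq_space V \<phi>) (null_seqs V \<phi>)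
       (\<lambda>C. THE D. \<exists>k. \<exists>x\<in>carrier (V k). C = phi_ddot V \<phi> k x \<and> D = phi_ddot V \<phi> k (star (V k) x))
       {phi_ddot V \<phi> k x | k x. x \<in> carrier (V k) \<and> (\<exists>m\<ge>k. phi_to \<phi> k m x \<in> pos (V m))}
       (phi_ddot V \<phi> 0 (ounit (V 0)))"

definition state_null :: "('a, 'm) star_ou_space_scheme \<Rightarrow> 'a set" where
  "state_null W = {x \<in> carrier W. \<forall>f\<in>states W. f x = 0}"

definition quot_map ::
  "(nat \<Rightarrow> 'a star_ou_space) \<Rightarrow> (nat \<Rightarrow> 'a \<Rightarrow> 'a) \<Rightarrow> (nat \<Rightarrow> 'a) set \<Rightarrow> (nat \<Rightarrow> 'a) set set" where
  "quot_map V \<phi> C = state_null (V_ddot V \<phi>) +>\<^bsub>V_ddot V \<phi>\<^esub> C"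

definition V_inf ::
  "(nat \<Rightarrow> 'a star_ou_space) \<Rightarrow> (nat \<Rightarrow> 'a \<Rightarrow> 'a) \<Rightarrow> (nat \<Rightarrow> 'a) set set star_ou_space" where
  "V_inf V \<phi> =
     quotient_space (V_ddot V \<phi>) (state_null (V_ddot V \<phi>))
       (\<lambda>C. \<Union>x\<in>C. quot_map V \<phi> (star (V_ddot V \<phi>) x))
       {quot_map V \<phi> (phi_ddot V \<phi> k x) | k x. x \<in> hermitian (V k) \<and>
          (\<forall>r>0. phi_ddot V \<phi> k x \<oplus>\<^bsub>V_ddot V \<phi>\<^esub>
                   (complex_of_real r \<odot>\<^bsub>V_ddot V \<phi>\<^esub> ounit (V_ddot V \<phi>)) \<in> pos (V_ddot V \<phi>))}
       (quot_map V \<phi> (ounit (V_ddot V \<phi>)))"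

definition phi_inf ::
  "(nat \<Rightarrow> 'a star_ou_space) \<Rightarrow> (nat \<Rightarrow> 'a \<Rightarrow> 'a) \<Rightarrow> nat \<Rightarrow> 'a \<Rightarrow> (nat \<Rightarrow> 'a) set set" where
  "phi_inf V \<phi> k = quot_map V \<phi> \<circ> phi_ddot V \<phi> k"

end

(*
The only analytic ingredient is a Hahn-Banach argument: in an ordered *-vector space with order
unit e, a hermitian x killed by all states satisfies r e + x >= 0 for every r > 0. If not, extend
the cone by -(r e + x) and then, by Zorn's lemma, to a maximal cone Q not containing -e. Maximality
makes Q total (y or -y lies in Q), so f y = sup {t. y - t e in Q} is a state, and f x <= -r.

Hence the cone of the Archimedeanisation W/N pulls back exactly to {x. r e + x >= 0 for all r > 0},
which makes W/N an AOU space, and a unital positive map from W into an AOU space kills N: on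
hermitian elements of N it takes values in the cone and in its negative. The sequential colimit of
ordered *-vector spaces has its own universal property for elementary reasons, and the two
factorisations compose.
*)

theory Submission
  imports Defs
begin

section \<open>Complex modules\<close>

text \<open>Every stage of the system is Archimedean, but the colimit need not be: for a class
  \<open>C\<close>, the stage at which \<open>r e + C\<close> becomes positive may recede as
  \<open>r\<close> tends to 0. The intermediate objects are therefore only order unit spaces, and
  the existence of states has to be proved at that generality. In such a space a nonzero vector and
  its negative can both lie in the closure of the cone; dividing by the common kernel of the states
  removes exactly this defect. The order lives on hermitian vectors. States are built there, and
  kernel elements are studied there; the decomposition \<open>x = re_part x + i im_part x\<close>
  carries the results to all vectors. This works because unital positive maps commute with the
  involution and the common kernel of the states is invariant under it. The case
  \<open>e = 0\<close> is not excluded. The order unit then makes every hermitian vector positive,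
  so properness of the cone makes the space zero, and it has no states.\<close>

locale complex_module = module "ring_of_type_algebra :: complex ring" M
  for M :: "(complex, 'a, 'm) module_scheme" (structure)
begin

text \<open>The axioms of \<open>module\<close> speak of the operations of the record
  \<open>ring_of_type_algebra\<close>. These lemmas restate them with the arithmetic of type
  \<open>complex\<close>, so that the simplifier can compute with coefficients.\<close>

lemma smult_mem [simp, intro]: "x \<in> carrier M \<Longrightarrow> c \<odot> x \<in> carrier M"
  using smult_closed by (simp add: ring_of_type_algebra_def)

lemma smult_add_left: "x \<in> carrier M \<Longrightarrow> (a + b) \<odot> x = a \<odot> x \<oplus> b \<odot> x"
  using smult_l_distr by (simp add: ring_of_type_algebra_def)

lemma smult_add_right:
  "x \<in> carrier M \<Longrightarrow> y \<in> carrier M \<Longrightarrow> a \<odot> (x \<oplus> y) = a \<odot> x \<oplus> a \<odot> y"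
  using smult_r_distr by (simp add: ring_of_type_algebra_def)

lemma smult_smult: "x \<in> carrier M \<Longrightarrow> a \<odot> (b \<odot> x) = (a * b) \<odot> x"
  using smult_assoc1 by (simp add: ring_of_type_algebra_def)

lemma smult_1: "x \<in> carrier M \<Longrightarrow> 1 \<odot> x = x"
  using smult_one by (simp add: ring_of_type_algebra_def)

lemma smult_0: "x \<in> carrier M \<Longrightarrow> 0 \<odot> x = \<zero>"
  using smult_l_null by (simp add: ring_of_type_algebra_def)

lemma smult_zero: "a \<odot> \<zero> = \<zero>"
  using smult_r_null by (simp add: ring_of_type_algebra_def)

lemma minus_eq_smult: "x \<in> carrier M \<Longrightarrow> \<ominus> x = (-1) \<odot> x"
  by (rule minus_equality) (use smult_add_left[of x "-1" 1] in \<open>simp_all add: smult_1 smult_0\<close>)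

text \<open>
  The map \<open>E\<close> is opaque to the simplifier, so rewriting the vectors by these equations reduces
  an identity between linear combinations to identities between their coefficients.
\<close>

lemma coordinates:
  assumes x: "x \<in> carrier M" and y: "y \<in> carrier M" and z: "z \<in> carrier M"
  obtains E where "x = E 1 0 0" "y = E 0 1 0" "z = E 0 0 1" "\<zero> = E 0 0 0"
    "\<And>a b c a' b' c'. E a b c \<oplus> E a' b' c' = E (a + a') (b + b') (c + c')"
    "\<And>s a b c. s \<odot> E a b c = E (s * a) (s * b) (s * c)"
    "\<And>a b c. \<ominus> E a b c = E (- a) (- b) (- c)"
    "\<And>a b c a' b' c'. E a b c \<ominus> E a' b' c' = E (a - a') (b - b') (c - c')"
proof -
  define E where "E a b c = a \<odot> x \<oplus> (b \<odot> y \<oplus> c \<odot> z)" for a b c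
  have clo: "E a b c \<in> carrier M" for a b c using assms by (simp add: E_def)
  have sm: "s \<odot> E a b c = E (s * a) (s * b) (s * c)" for s a b c
    using assms by (simp add: E_def smult_add_right smult_smult)
  have ad: "E a b c \<oplus> E a' b' c' = E (a + a') (b + b') (c + c')" for a b c a' b' c'
    using assms by (simp add: E_def smult_add_left M.a_ac)
  have mi: "\<ominus> E a b c = E (- a) (- b) (- c)" for a b c
    using clo by (simp add: minus_eq_smult sm)
  show thesis
    by (rule that[of E]; (simp add: sm ad mi minus_eq)?)
       (use assms in \<open>simp_all add: E_def smult_0 smult_1\<close>)
qed

end

section \<open>Hermitian elements\<close>

sublocale star_vector_space \<subseteq> complex_module V
  by unfold_locales

context star_vector_space
begin

lemma hermitian_carrier: "x \<in> hermitian V \<Longrightarrow> x \<in> carrier V"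
  by (simp add: hermitian_def)

lemma star_zero: "star V \<zero> = \<zero>"
  using star_smult[of "\<zero>" 0] by (simp add: smult_0 star_closed)

lemma hermitian_zero: "\<zero> \<in> hermitian V"
  by (simp add: hermitian_def star_zero)

lemma hermitian_add: "x \<in> hermitian V \<Longrightarrow> y \<in> hermitian V \<Longrightarrow> x \<oplus> y \<in> hermitian V"
  by (simp add: hermitian_def star_add)

lemma hermitian_smult: "x \<in> hermitian V \<Longrightarrow> complex_of_real r \<odot> x \<in> hermitian V"
  by (simp add: hermitian_def star_smult)

lemma hermitian_uminus: "x \<in> hermitian V \<Longrightarrow> \<ominus> x \<in> hermitian V"
  using hermitian_smult[of x "-1"] by (simp add: minus_eq_smult hermitian_carrier)

lemma hermitian_minus: "x \<in> hermitian V \<Longrightarrow> y \<in> hermitian V \<Longrightarrow> x \<ominus> y \<in> hermitian V"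
  by (simp add: minus_eq hermitian_add hermitian_uminus)

definition re_part where "re_part x = (1/2) \<odot> (x \<oplus> star V x)"
definition im_part where "im_part x = (-\<i>/2) \<odot> (x \<ominus> star V x)"

lemma star_minus: "x \<in> carrier V \<Longrightarrow> y \<in> carrier V \<Longrightarrow> star V (x \<ominus> y) = star V x \<ominus> star V y"
  by (simp add: minus_eq minus_eq_smult star_add star_smult star_closed)

lemma re_part_hermitian: "x \<in> carrier V \<Longrightarrow> re_part x \<in> hermitian V"
  by (simp add: hermitian_def re_part_def star_smult star_add star_closed star_star M.a_comm)

lemma im_part_hermitian:
  assumes x: "x \<in> carrier V" shows "im_part x \<in> hermitian V"
proof -
  have "(\<i>/2) \<odot> (star V x \<ominus> x) = (-\<i>/2) \<odot> (x \<ominus> star V x)"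
    by (rule coordinates[OF x star_closed[OF x] x]) simp
  then show ?thesis
    using x by (simp add: hermitian_def im_part_def star_smult star_minus star_closed star_star)
qed

lemma re_im_parts:
  assumes x: "x \<in> carrier V" shows "x = re_part x \<oplus> \<i> \<odot> im_part x"
  unfolding re_part_def im_part_def
  by (rule coordinates[OF x star_closed[OF x] x]) simp

lemma re_part_add:
  assumes "x \<in> carrier V" "y \<in> carrier V" shows "re_part (x \<oplus> y) = re_part x \<oplus> re_part y"
  using assms by (simp add: re_part_def star_add star_closed smult_add_right M.a_ac)

lemma im_part_add:
  assumes "x \<in> carrier V" "y \<in> carrier V" shows "im_part (x \<oplus> y) = im_part x \<oplus> im_part y"
  using assms
  by (simp add: im_part_def star_add star_closed minus_eq minus_eq_smult smult_add_right M.a_ac)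

text \<open>Multiplication of a + bi by u + iv, read off in its hermitian parts. With this formula a
  real-linear functional on hermitian vectors becomes complex-linear on the whole space.\<close>

lemma re_part_smult:
  assumes x: "x \<in> carrier V"
  shows "re_part (c \<odot> x) = complex_of_real (Re c) \<odot> re_part x \<oplus> complex_of_real (- Im c) \<odot> im_part x"
  unfolding re_part_def im_part_def star_smult[OF x]
  by (rule coordinates[OF x star_closed[OF x] x])
     (cases c, simp add: Complex_eq add_divide_distrib
         diff_divide_distrib algebra_simps)

lemma im_part_smult:
  assumes x: "x \<in> carrier V"
  shows "im_part (c \<odot> x) = complex_of_real (Re c) \<odot> im_part x \<oplus> complex_of_real (Im c) \<odot> re_part x"
  unfolding re_part_def im_part_def star_smult[OF x]
  by (rule coordinates[OF x star_closed[OF x] x])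
     (cases c, simp add: Complex_eq add_divide_distrib
         diff_divide_distrib algebra_simps)

lemma re_part_of_hermitian:
  assumes "x \<in> hermitian V" shows "re_part x = x"
proof -
  have x: "x \<in> carrier V" and s: "star V x = x" using assms by (auto simp: hermitian_def)
  show ?thesis unfolding re_part_def s by (rule coordinates[OF x x x]) simp
qed

lemma im_part_of_hermitian:
  assumes "x \<in> hermitian V" shows "im_part x = \<zero>"
proof -
  have x: "x \<in> carrier V" and s: "star V x = x" using assms by (auto simp: hermitian_def)
  show ?thesis unfolding im_part_def s by (rule coordinates[OF x x x]) simp
qed

end

section \<open>Existence of states\<close>

text \<open>What remains of an AOU space without the Archimedean axiom; this is the structure that
  survives in the algebraic colimit.\<close>

locale order_unit_space = ordered_star_vector_space +
  assumes ounit_pos: "ounit V \<in> pos V"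
    and order_unit:
      "x \<in> hermitian V \<Longrightarrow> \<exists>r>0. complex_of_real r \<odot> ounit V \<ominus> x \<in> pos V"

sublocale aou_space \<subseteq> order_unit_space
  by unfold_locales (use ounit_pos order_unit in auto)

section \<open>Maximal cones and the states they determine\<close>

context order_unit_space
begin

text \<open>Properness is deliberately not demanded: a maximal wedge contains lines, on which its
  state vanishes. Excluding the single vector \<open>-e\<close> keeps the cone from becoming
  everything, and this condition passes to unions of chains.\<close>

definition wedge :: "'a set \<Rightarrow> bool" where
  "wedge Q \<longleftrightarrow> Q \<subseteq> hermitian V \<and> pos V \<subseteq> Q \<and> \<ominus> ounit V \<notin> Q \<and>
     (\<forall>x\<in>Q. \<forall>y\<in>Q. x \<oplus> y \<in> Q) \<and> (\<forall>r\<ge>0. \<forall>x\<in>Q. complex_of_real r \<odot> x \<in> Q)"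

lemma pos_carrier: "x \<in> pos V \<Longrightarrow> x \<in> carrier V"
  using pos_hermitian hermitian_carrier by blast

lemma ounit_carrier [simp]: "ounit V \<in> carrier V"
  using ounit_pos pos_carrier by blast

lemma ounit_hermitian: "ounit V \<in> hermitian V"
  using ounit_pos pos_hermitian by blast

lemma pos_antisym:
  assumes "x \<in> pos V" "\<ominus> x \<in> pos V" shows "x = \<zero>"
proof -
  have "x = \<ominus> (\<ominus> x)" using assms(1) by (simp add: pos_carrier)
  then have "x \<in> pos V \<inter> {\<ominus> x | x. x \<in> pos V}" using assms by blast
  then show ?thesis using pos_proper by simp
qed

text \<open>Adjoining \<open>y\<close> can fail only by producing \<open>-e = q + r y\<close>. Here
  \<open>r\<close> is nonzero because \<open>-e\<close> is not in \<open>Q\<close>, and solving for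
  \<open>y\<close> gives \<open>-y = (q + e) / r\<close>, which lies in \<open>Q\<close> contrary to
  the hypothesis.\<close>

lemma wedge_extend:
  assumes Q: "wedge Q" and y: "y \<in> hermitian V" and ny: "\<ominus> y \<notin> Q"
  shows "\<exists>Q'. wedge Q' \<and> Q \<subseteq> Q' \<and> y \<in> Q'"
proof -
  let ?Q = "{q \<oplus> complex_of_real r \<odot> y | q r. q \<in> Q \<and> 0 \<le> r}"
  have smQ: "complex_of_real r \<odot> q \<in> Q" if "q \<in> Q" "0 \<le> r" for q r
    using Q that by (simp add: wedge_def)
  have adQ: "p \<oplus> q \<in> Q" if "p \<in> Q" "q \<in> Q" for p q
    using Q that by (simp add: wedge_def)
  have eQ: "ounit V \<in> Q" using Q ounit_pos by (auto simp: wedge_def)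
  have QH: "q \<in> hermitian V" "q \<in> carrier V" if "q \<in> Q" for q
    using Q that by (auto simp: wedge_def hermitian_carrier)
  have yc: "y \<in> carrier V" using y by (rule hermitian_carrier)
  have sub: "Q \<subseteq> ?Q"
  proof
    fix q assume q: "q \<in> Q"
    have "q = q \<oplus> complex_of_real 0 \<odot> y" using QH[OF q] yc by (simp add: smult_0)
    then show "q \<in> ?Q" using q by fastforce
  qed
  have zQ: "\<zero> \<in> Q" using Q pos_zero by (auto simp: wedge_def)
  have yQ: "y \<in> ?Q"
  proof -
    have "y = \<zero> \<oplus> complex_of_real 1 \<odot> y" using yc by (simp add: smult_1)
    then show ?thesis using zQ by fastforce
  qed
  have herm: "?Q \<subseteq> hermitian V" using QH y by (auto intro: hermitian_add hermitian_smult)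
  have add: "a \<oplus> b \<in> ?Q" if a: "a \<in> ?Q" and b: "b \<in> ?Q" for a b
  proof -
    obtain p r where a: "a = p \<oplus> complex_of_real r \<odot> y" "p \<in> Q" "0 \<le> r" using a by auto
    obtain q s where b: "b = q \<oplus> complex_of_real s \<odot> y" "q \<in> Q" "0 \<le> s" using b by auto
    have "a \<oplus> b = (p \<oplus> q) \<oplus> complex_of_real (r + s) \<odot> y"
      unfolding a b by (rule coordinates[OF QH(2)[OF a(2)] QH(2)[OF b(2)] yc]) simp
    moreover have "p \<oplus> q \<in> Q" using Q a b by (auto simp: wedge_def)
    moreover have "0 \<le> r + s" using a b by simp
    ultimately show ?thesis by blast
  qed
  have sm: "complex_of_real t \<odot> a \<in> ?Q" if a: "a \<in> ?Q" and t: "0 \<le> t" for a t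
  proof -
    obtain p r where a: "a = p \<oplus> complex_of_real r \<odot> y" "p \<in> Q" "0 \<le> r" using a by auto
    have "complex_of_real t \<odot> a = complex_of_real t \<odot> p \<oplus> complex_of_real (t * r) \<odot> y"
      unfolding a by (rule coordinates[OF QH(2)[OF a(2)] yc yc]) simp
    moreover have "complex_of_real t \<odot> p \<in> Q" using Q a t by (auto simp: wedge_def)
    moreover have "0 \<le> t * r" using a t by simp
    ultimately show ?thesis by blast
  qed
  have ne: "\<ominus> ounit V \<notin> ?Q"
  proof
    assume "\<ominus> ounit V \<in> ?Q"
    then obtain q r where q: "\<ominus> ounit V = q \<oplus> complex_of_real r \<odot> y" "q \<in> Q" "0 \<le> r" by auto
    have "r \<noteq> 0" using q QH[OF q(2)] Q yc by (auto simp: wedge_def smult_0)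
    then have r: "r > 0" using q by simp
    \<comment> \<open>The vector \<open>q\<close> is inserted and removed again so that the
      expression for \<open>-e\<close> appears literally and can be replaced.\<close>
    have "\<ominus> y = complex_of_real (1 / r) \<odot> (q \<ominus> (q \<oplus> complex_of_real r \<odot> y))"
      by (rule coordinates[OF QH(2)[OF q(2)] yc yc]) (use r in simp)
    also have "\<dots> = complex_of_real (1 / r) \<odot> (q \<oplus> ounit V)"
      unfolding q(1)[symmetric] by (rule coordinates[OF QH(2)[OF q(2)] ounit_carrier yc]) simp
    also have "\<dots> \<in> Q" by (intro smQ adQ q eQ) (use r in simp)
    finally show False using ny by simp
  qed
  have "wedge ?Q"
    unfolding wedge_def
  proof (intro conjI ballI allI impI)
    show "pos V \<subseteq> ?Q" using Q sub by (auto simp only: wedge_def)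
  qed (use herm ne add sm in \<open>blast\<close>)+
  then show ?thesis using sub yQ by blast
qed

text \<open>If a maximal wedge contains neither \<open>y\<close> nor \<open>-y\<close>, then
  \<open>wedge_extend\<close> enlarges it, against maximality.\<close>

lemma exists_total_wedge:
  assumes "wedge P"
  obtains Q where "wedge Q" "P \<subseteq> Q" "\<And>y. y \<in> hermitian V \<Longrightarrow> y \<in> Q \<or> \<ominus> y \<in> Q"
proof -
  define A where "A = {Q. wedge Q \<and> P \<subseteq> Q}"
  have "\<exists>Q\<in>A. \<forall>R\<in>A. Q \<subseteq> R \<longrightarrow> R = Q"
  \<comment> \<open>Only nonempty chains need an upper bound in this form of Zorn's lemma; a member
    of the chain then supplies the inclusion of \<open>pos V\<close> and of \<open>P\<close> in the
    union.\<close>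
  proof (rule subset_Zorn_nonempty)
    show "A \<noteq> {}" using assms by (auto simp: A_def)
    fix C assume C: "C \<noteq> {}" "subset.chain A C"
    have ch: "S \<subseteq> T \<or> T \<subseteq> S" if "S \<in> C" "T \<in> C" for S T
      using C(2) that by (simp add: subset_chain_def)
    have "C \<subseteq> A" using C(2) by (simp add: subset_chain_def)
    then have CA: "wedge R" "P \<subseteq> R" if "R \<in> C" for R
      using that by (auto simp: A_def)
    obtain R\<^sub>0 where R\<^sub>0: "R\<^sub>0 \<in> C" using C(1) by blast
    have "wedge (\<Union>C)"
      unfolding wedge_def
    proof (intro conjI ballI allI impI)
      show "\<Union>C \<subseteq> hermitian V" using CA(1) by (intro Union_least) (simp add: wedge_def)
      show "pos V \<subseteq> \<Union>C"
        by (rule order_trans[OF _ Union_upper[OF R\<^sub>0]]) (use CA(1)[OF R\<^sub>0] in \<open>simp add: wedge_def\<close>)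
      show "\<ominus> ounit V \<notin> \<Union>C" using CA(1) by (simp add: wedge_def)
    next
      fix x y assume xy: "x \<in> \<Union>C" "y \<in> \<Union>C"
      obtain S T where "S \<in> C" "x \<in> S" "T \<in> C" "y \<in> T" using xy by blast
      then obtain R where R: "R \<in> C" "x \<in> R" "y \<in> R" using ch[of S T] by (meson subsetD)
      then have "x \<oplus> y \<in> R" using CA(1)[OF R(1)] by (simp add: wedge_def)
      with R(1) show "x \<oplus> y \<in> \<Union>C" by (rule UnionI)
    next
      fix r :: real and x assume r: "0 \<le> r" and x: "x \<in> \<Union>C"
      then obtain R where R: "R \<in> C" "x \<in> R" by blast
      then have "complex_of_real r \<odot> x \<in> R" using CA(1)[OF R(1)] r by (simp add: wedge_def)
      with R(1) show "complex_of_real r \<odot> x \<in> \<Union>C" by (rule UnionI)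
    qed
    moreover have "P \<subseteq> \<Union>C" using CA(2)[OF R\<^sub>0] Union_upper[OF R\<^sub>0] by (rule order_trans)
    ultimately show "\<Union>C \<in> A" by (simp add: A_def)
  qed
  then obtain Q where "Q \<in> A" and max: "\<forall>R\<in>A. Q \<subseteq> R \<longrightarrow> R = Q" by (elim bexE)
  then have Q: "wedge Q" "P \<subseteq> Q" by (simp_all add: A_def)
  show thesis
  proof (rule that[OF Q], rule disjCI)
    fix y assume y: "y \<in> hermitian V" "\<ominus> y \<notin> Q"
    obtain R where R: "wedge R" "Q \<subseteq> R" "y \<in> R" using wedge_extend[OF Q(1) y] by metis
    then have "R = Q" using bspec[OF max, of R] Q(2) by (simp add: A_def)
    then show "y \<in> Q" using R(3) by simp
  qed
qed

text \<open>The cone \<open>Q\<close> is the nonnegative half-space of the state \<open>f\<close>, up to its boundary.\<close>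

lemma state_of_total_wedge:
  assumes Q: "wedge Q" and total: "\<And>y. y \<in> hermitian V \<Longrightarrow> y \<in> Q \<or> \<ominus> y \<in> Q"
  obtains f where "f \<in> states V" "\<And>y. y \<in> Q \<Longrightarrow> f y \<in> \<real>\<^sub>\<ge>\<^sub>0"
proof -
  let ?e = "ounit V"
  \<comment> \<open>\<open>val y a\<close> pins down the supremum by two-sided estimates:
    \<open>y - (a - \<epsilon>) e\<close> and \<open>(a + \<epsilon>) e - y\<close> lie in
    \<open>Q\<close>. The slack \<epsilon> is needed because \<open>Q\<close> need not be closed. In
    this form addition and scaling are checked by adding and scaling memberships, without
    manipulating suprema.\<close>
  define val where "val y a \<longleftrightarrow> (\<forall>\<epsilon>>0. y \<oplus> complex_of_real (\<epsilon> - a) \<odot> ?e \<in> Q \<and>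
      complex_of_real (a + \<epsilon>) \<odot> ?e \<ominus> y \<in> Q)" for y a
  have valD1: "y \<oplus> complex_of_real (\<epsilon> - a) \<odot> ?e \<in> Q"
    and valD2: "complex_of_real (a + \<epsilon>) \<odot> ?e \<ominus> y \<in> Q" if "val y a" "0 < \<epsilon>" for y a \<epsilon>
    using that unfolding val_def by blast+
  have smQ: "complex_of_real r \<odot> q \<in> Q" if "q \<in> Q" "0 \<le> r" for q r
    using Q that by (simp add: wedge_def)
  have adQ: "p \<oplus> q \<in> Q" if "p \<in> Q" "q \<in> Q" for p q
    using Q that by (simp add: wedge_def)
  have posQ: "p \<in> Q" if "p \<in> pos V" for p using Q that by (auto simp: wedge_def)
  have QH: "q \<in> hermitian V" "q \<in> carrier V" if "q \<in> Q" for q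
    using Q that by (auto simp: wedge_def hermitian_carrier)
  \<comment> \<open>Inequalities between numbers are read off from membership through this
    equivalence. The exclusion of \<open>-e\<close> from \<open>Q\<close> enters here, after
    rescaling a negative multiple of \<open>e\<close>.\<close>
  have eQ: "complex_of_real r \<odot> ?e \<in> Q \<longleftrightarrow> 0 \<le> r" for r
  proof
    assume r: "complex_of_real r \<odot> ?e \<in> Q"
    show "0 \<le> r"
    proof (rule ccontr)
      assume "\<not> 0 \<le> r"
      then have "complex_of_real (1 / -r) \<odot> (complex_of_real r \<odot> ?e) = \<ominus> ?e"
        by (simp add: smult_smult minus_eq_smult)
      moreover have "complex_of_real (1 / -r) \<odot> (complex_of_real r \<odot> ?e) \<in> Q"
        using \<open>\<not> 0 \<le> r\<close> by (intro smQ[OF r]) simp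
      ultimately show False using Q by (simp add: wedge_def)
    qed
  qed (simp add: smQ posQ ounit_pos)
  have val_le: "a \<le> b" if y: "y \<in> carrier V" and "val y a" "val y b" for y a b
  proof (rule field_le_epsilon)
    fix \<epsilon> :: real assume "0 < \<epsilon>"
    then obtain \<delta> where \<delta>: "\<epsilon> = \<delta> + \<delta>" "0 < \<delta>" by (metis field_sum_of_halves half_gt_zero)
    \<comment> \<open>In the estimate from below by \<open>a\<close> and the one from above by
      \<open>b\<close>, \<open>y\<close> has opposite signs, so their sum is a multiple of
      \<open>e\<close>. Each estimate uses half of the slack.\<close>
    have "(y \<oplus> complex_of_real (\<delta> - a) \<odot> ?e) \<oplus> (complex_of_real (b + \<delta>) \<odot> ?e \<ominus> y) \<in> Q"
      by (rule adQ[OF valD1[OF that(2)] valD2[OF that(3)]]) (use \<delta> in simp_all)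
    also have "(y \<oplus> complex_of_real (\<delta> - a) \<odot> ?e) \<oplus> (complex_of_real (b + \<delta>) \<odot> ?e \<ominus> y)
        = complex_of_real (b + \<epsilon> - a) \<odot> ?e"
      by (rule coordinates[OF y ounit_carrier y]) (simp add: \<delta> algebra_simps)
    finally show "a \<le> b + \<epsilon>" by (simp only: eQ)
  qed
  have val_unique: "a = b" if "y \<in> carrier V" "val y a" "val y b" for y a b
    using val_le[OF that(1,2,3)] val_le[OF that(1,3,2)] by simp
  have val_exists: "\<exists>a. val y a" if yH: "y \<in> hermitian V" for y
  proof -
    have y: "y \<in> carrier V" using yH by (rule hermitian_carrier)
    \<comment> \<open>A lower cut in the reals. The order unit applied to \<open>-y\<close> makes it
      nonempty, and applied to \<open>y\<close> it bounds it above.\<close>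
    define T where "T = {t. y \<oplus> complex_of_real (- t) \<odot> ?e \<in> Q}"
    obtain r where r: "complex_of_real r \<odot> ?e \<ominus> y \<in> pos V" using order_unit[OF yH] by blast
    obtain s where s: "complex_of_real s \<odot> ?e \<ominus> (\<ominus> y) \<in> pos V"
      using order_unit[OF hermitian_uminus[OF yH]] by blast
    have "complex_of_real s \<odot> ?e \<ominus> (\<ominus> y) = y \<oplus> complex_of_real (- (- s)) \<odot> ?e"
      by (rule coordinates[OF y ounit_carrier y]) (simp add: algebra_simps)
    then have "- s \<in> T" unfolding T_def mem_Collect_eq using posQ[OF s] by (simp only:)
    then have ne: "T \<noteq> {}" by blast
    have bd: "t \<le> r" if "t \<in> T" for t
    proof -
      have "(y \<oplus> complex_of_real (- t) \<odot> ?e) \<oplus> (complex_of_real r \<odot> ?e \<ominus> y) \<in> Q"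
        by (rule adQ[OF _ posQ[OF r]]) (use that in \<open>simp only: T_def mem_Collect_eq\<close>)
      also have "(y \<oplus> complex_of_real (- t) \<odot> ?e) \<oplus> (complex_of_real r \<odot> ?e \<ominus> y)
          = complex_of_real (r - t) \<odot> ?e"
        by (rule coordinates[OF y ounit_carrier y]) (simp add: algebra_simps)
      finally show ?thesis by (simp only: eQ)
    qed
    then have bdd: "bdd_above T" by (rule bdd_aboveI)
    have "val y (Sup T)"
      unfolding val_def
    proof (intro allI impI conjI)
      fix \<epsilon> :: real assume \<epsilon>: "0 < \<epsilon>"
      then obtain t where t: "t \<in> T" "Sup T - \<epsilon> < t"
        using less_cSupE[OF _ ne, of "Sup T - \<epsilon>"] by auto
      have "(y \<oplus> complex_of_real (- t) \<odot> ?e) \<oplus> complex_of_real (t + \<epsilon> - Sup T) \<odot> ?e \<in> Q"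
        by (rule adQ[OF _ smQ[OF posQ[OF ounit_pos]]]) (use t in \<open>simp_all add: T_def\<close>)
      also have "(y \<oplus> complex_of_real (- t) \<odot> ?e) \<oplus> complex_of_real (t + \<epsilon> - Sup T) \<odot> ?e
          = y \<oplus> complex_of_real (\<epsilon> - Sup T) \<odot> ?e"
        by (rule coordinates[OF y ounit_carrier y]) (simp add: algebra_simps)
      finally show "y \<oplus> complex_of_real (\<epsilon> - Sup T) \<odot> ?e \<in> Q" .
      \<comment> \<open>The upper estimate comes from totality: a vector just beyond the cut is not
        in \<open>Q\<close>, hence its negative is.\<close>
      have "Sup T + \<epsilon> \<notin> T" using cSup_upper[OF _ bdd, of "Sup T + \<epsilon>"] \<epsilon> by auto
      then have "y \<oplus> complex_of_real (- (Sup T + \<epsilon>)) \<odot> ?e \<notin> Q" by (simp only: T_def mem_Collect_eq) simp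
      then have "\<ominus> (y \<oplus> complex_of_real (- (Sup T + \<epsilon>)) \<odot> ?e) \<in> Q"
        using total hermitian_add[OF yH hermitian_smult[OF ounit_hermitian]] by blast
      also have "\<ominus> (y \<oplus> complex_of_real (- (Sup T + \<epsilon>)) \<odot> ?e)
          = complex_of_real (Sup T + \<epsilon>) \<odot> ?e \<ominus> y"
        by (rule coordinates[OF y ounit_carrier y]) (simp add: algebra_simps)
      finally show "complex_of_real (Sup T + \<epsilon>) \<odot> ?e \<ominus> y \<in> Q" .
    qed
    then show ?thesis ..
  qed
  define g where "g y = (THE a. val y a)" for y
  have g: "val y (g y)" if "y \<in> hermitian V" for y
    unfolding g_def
    using val_exists[OF that] val_unique[OF hermitian_carrier[OF that]] by (blast intro: theI)
  have g_eq: "g y = a" if "y \<in> hermitian V" "val y a" for y a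
    using val_unique[OF hermitian_carrier[OF that(1)] g[OF that(1)] that(2)] .
  have g_add: "g (y \<oplus> z) = g y + g z" if yH: "y \<in> hermitian V" and zH: "z \<in> hermitian V" for y z
  proof (rule g_eq)
    have y: "y \<in> carrier V" and z: "z \<in> carrier V" using that by (auto simp: hermitian_carrier)
    show "val (y \<oplus> z) (g y + g z)"
      unfolding val_def
    proof (intro allI impI conjI)
      fix \<epsilon> :: real assume "0 < \<epsilon>"
      then obtain \<delta> where \<delta>: "\<epsilon> = \<delta> + \<delta>" "0 < \<delta>" by (metis field_sum_of_halves half_gt_zero)
      have "(y \<oplus> complex_of_real (\<delta> - g y) \<odot> ?e) \<oplus> (z \<oplus> complex_of_real (\<delta> - g z) \<odot> ?e) \<in> Q"
        by (rule adQ[OF valD1[OF g[OF yH]] valD1[OF g[OF zH]]]) (use \<delta> in simp_all)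
      also have "(y \<oplus> complex_of_real (\<delta> - g y) \<odot> ?e) \<oplus> (z \<oplus> complex_of_real (\<delta> - g z) \<odot> ?e)
          = y \<oplus> z \<oplus> complex_of_real (\<epsilon> - (g y + g z)) \<odot> ?e"
        by (rule coordinates[OF y ounit_carrier z]) (simp add: \<delta> algebra_simps)
      finally show "y \<oplus> z \<oplus> complex_of_real (\<epsilon> - (g y + g z)) \<odot> ?e \<in> Q" .
      have "(complex_of_real (g y + \<delta>) \<odot> ?e \<ominus> y) \<oplus> (complex_of_real (g z + \<delta>) \<odot> ?e \<ominus> z) \<in> Q"
        by (rule adQ[OF valD2[OF g[OF yH]] valD2[OF g[OF zH]]]) (use \<delta> in simp_all)
      also have "(complex_of_real (g y + \<delta>) \<odot> ?e \<ominus> y) \<oplus> (complex_of_real (g z + \<delta>) \<odot> ?e \<ominus> z)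
          = complex_of_real (g y + g z + \<epsilon>) \<odot> ?e \<ominus> (y \<oplus> z)"
        by (rule coordinates[OF y ounit_carrier z]) (simp add: \<delta> algebra_simps)
      finally show "complex_of_real (g y + g z + \<epsilon>) \<odot> ?e \<ominus> (y \<oplus> z) \<in> Q" .
    qed
  qed (intro hermitian_add yH zH)
  have g_minus: "g (\<ominus> y) = - g y" if yH: "y \<in> hermitian V" for y
  proof -
    have "\<ominus> y \<oplus> y = \<zero>" using yH by (simp add: hermitian_carrier M.l_neg)
    then have "g (\<ominus> y) + g y = g \<zero>"
      using g_add[OF hermitian_uminus[OF yH] yH] by simp
    moreover have "g \<zero> = 0" using g_add[OF hermitian_zero hermitian_zero] by simp
    ultimately show ?thesis by simp
  qed
  \<comment> \<open>Scaling by a positive number preserves \<open>Q\<close>, with the slack chosen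
    as \<epsilon> / r to compensate. Zero and negative factors are then reduced to
    additivity.\<close>
  have g_pos_smult: "g (complex_of_real r \<odot> y) = r * g y" if yH: "y \<in> hermitian V" and r: "0 < r" for y r
  proof (rule g_eq)
    have y: "y \<in> carrier V" using that by (auto simp: hermitian_carrier)
    show "val (complex_of_real r \<odot> y) (r * g y)"
      unfolding val_def
    proof (intro allI impI conjI)
      fix \<epsilon> :: real assume \<epsilon>: "0 < \<epsilon>"
      have "complex_of_real r \<odot> (y \<oplus> complex_of_real (\<epsilon> / r - g y) \<odot> ?e) \<in> Q"
        by (rule smQ[OF valD1[OF g[OF yH]]]) (use \<epsilon> r in simp_all)
      also have "complex_of_real r \<odot> (y \<oplus> complex_of_real (\<epsilon> / r - g y) \<odot> ?e)
          = complex_of_real r \<odot> y \<oplus> complex_of_real (\<epsilon> - r * g y) \<odot> ?e"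
        by (rule coordinates[OF y ounit_carrier y]) (use r in \<open>simp add: algebra_simps\<close>)
      finally show "complex_of_real r \<odot> y \<oplus> complex_of_real (\<epsilon> - r * g y) \<odot> ?e \<in> Q" .
      have "complex_of_real r \<odot> (complex_of_real (g y + \<epsilon> / r) \<odot> ?e \<ominus> y) \<in> Q"
        by (rule smQ[OF valD2[OF g[OF yH]]]) (use \<epsilon> r in simp_all)
      also have "complex_of_real r \<odot> (complex_of_real (g y + \<epsilon> / r) \<odot> ?e \<ominus> y)
          = complex_of_real (r * g y + \<epsilon>) \<odot> ?e \<ominus> complex_of_real r \<odot> y"
        by (rule coordinates[OF y ounit_carrier y]) (use r in \<open>simp add: algebra_simps\<close>)
      finally show "complex_of_real (r * g y + \<epsilon>) \<odot> ?e \<ominus> complex_of_real r \<odot> y \<in> Q" .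
    qed
  qed (intro hermitian_smult yH)
  have g_smult: "g (complex_of_real r \<odot> y) = r * g y" if yH: "y \<in> hermitian V" for y r
  proof -
    have y: "y \<in> carrier V" using that by (auto simp: hermitian_carrier)
    consider "r > 0" | "r = 0" | "r < 0" by linarith
    then show ?thesis
    proof cases
      case 1 then show ?thesis using g_pos_smult[OF yH] by simp
    next
      case 2
      have "g \<zero> = 0" using g_add[OF hermitian_zero hermitian_zero] by simp
      then show ?thesis using 2 y by (simp add: smult_0)
    next
      case 3
      have "complex_of_real r \<odot> y = \<ominus> (complex_of_real (- r) \<odot> y)"
        by (rule coordinates[OF y y y]) (simp add: algebra_simps)
      then show ?thesis
        using 3 g_pos_smult[OF yH, of "- r"] g_minus[OF hermitian_smult[OF yH], of "- r"] by simp
    qed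
  qed
  have g_pos: "0 \<le> g y" if yQ: "y \<in> Q" for y
  proof (rule ccontr)
    assume "\<not> 0 \<le> g y"
    have y: "y \<in> carrier V" using QH yQ by blast
    \<comment> \<open>With \<open>h\<close> half of the supposedly negative value, \<open>-h\<close>
      is an admissible slack, and cancelling \<open>y\<close> leaves the negative multiple
      \<open>h e\<close> in \<open>Q\<close>.\<close>
    obtain h where h: "g y = h + h" by (metis field_sum_of_halves)
    then have "h < 0" using \<open>\<not> 0 \<le> g y\<close> by simp
    have "(complex_of_real (g y + - h) \<odot> ?e \<ominus> y) \<oplus> y \<in> Q"
      by (rule adQ[OF valD2[OF g[OF QH(1)[OF yQ]]] yQ]) (use \<open>h < 0\<close> in simp)
    also have "(complex_of_real (g y + - h) \<odot> ?e \<ominus> y) \<oplus> y = complex_of_real h \<odot> ?e"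
      unfolding h by (rule coordinates[OF y ounit_carrier y]) simp
    finally have "0 \<le> h" by (simp only: eQ)
    then show False using \<open>h < 0\<close> by simp
  qed
  \<comment> \<open>The real-linear functional \<open>g\<close> is complexified through the
    hermitian parts.\<close>
  define f where "f z = Complex (g (re_part z)) (g (im_part z))" for z
  have f_herm: "f y = complex_of_real (g y)" if "y \<in> hermitian V" for y
    using that g_add[OF hermitian_zero hermitian_zero]
    by (simp add: f_def re_part_of_hermitian im_part_of_hermitian complex_eq_iff)
  have fQ: "f y \<in> \<real>\<^sub>\<ge>\<^sub>0" if "y \<in> Q" for y
    using f_herm[OF QH(1)[OF that]] g_pos[OF that] by simp
  have "g ?e = 1"
  proof (rule g_eq[OF ounit_hermitian])
    show "val ?e 1"
      unfolding val_def
    proof (intro allI impI conjI)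
      fix \<epsilon> :: real assume \<epsilon>: "0 < \<epsilon>"
      have 1: "?e \<oplus> complex_of_real (\<epsilon> - 1) \<odot> ?e = complex_of_real \<epsilon> \<odot> ?e"
        by (rule coordinates[OF ounit_carrier ounit_carrier ounit_carrier]) (simp add: algebra_simps)
      have 2: "complex_of_real (1 + \<epsilon>) \<odot> ?e \<ominus> ?e = complex_of_real \<epsilon> \<odot> ?e"
        by (rule coordinates[OF ounit_carrier ounit_carrier ounit_carrier]) (simp add: algebra_simps)
      show "?e \<oplus> complex_of_real (\<epsilon> - 1) \<odot> ?e \<in> Q" "complex_of_real (1 + \<epsilon>) \<odot> ?e \<ominus> ?e \<in> Q"
        using \<epsilon> unfolding 1 2 by (simp_all add: eQ)
    qed
  qed
  then have "f ?e = 1" using f_herm[OF ounit_hermitian] by simp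
  moreover have "f (x \<oplus> y) = f x + f y" if "x \<in> carrier V" "y \<in> carrier V" for x y
    using that
    by (simp add: f_def re_part_add im_part_add g_add re_part_hermitian im_part_hermitian complex_eq_iff)
  \<comment> \<open>The rule \<open>of_real_minus\<close> is switched off so that the coefficient
    \<open>- Im c\<close> stays inside \<open>complex_of_real\<close>, where \<open>g_smult\<close>
    can match it.\<close>
  moreover have "f (c \<odot> x) = c * f x" if "x \<in> carrier V" for c x
    using that re_part_hermitian[OF that] im_part_hermitian[OF that]
    by (simp add: f_def re_part_smult im_part_smult g_add g_smult hermitian_smult complex_eq_iff
        del: of_real_minus)
  ultimately have "f \<in> states V" using fQ posQ by (auto simp: states_def)
  then show thesis using fQ that by blast
qed

lemma exists_state_nonzero:
  assumes xH: "x \<in> hermitian V" and r: "0 < r"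
    and nx: "complex_of_real r \<odot> ounit V \<oplus> x \<notin> pos V"
  obtains f where "f \<in> states V" "f x \<noteq> 0"
proof -
  let ?e = "ounit V" and ?y = "\<ominus> (complex_of_real r \<odot> ounit V \<oplus> x)"
  have x: "x \<in> carrier V" using xH by (rule hermitian_carrier)
  have yH: "?y \<in> hermitian V"
    by (intro hermitian_uminus hermitian_add hermitian_smult ounit_hermitian xH)
  have mm: "\<ominus> ?y = complex_of_real r \<odot> ?e \<oplus> x" using x by simp
  \<comment> \<open>The cone itself must qualify as a wedge. Otherwise \<open>e = 0\<close> by
    properness, and the order unit property applied to \<open>?y\<close> would already make
    \<open>r e + x\<close> positive.\<close>
  have "\<ominus> ?e \<notin> pos V"
  proof
    assume "\<ominus> ?e \<in> pos V"
    then have e: "?e = \<zero>" using pos_antisym[OF ounit_pos] by simp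
    obtain s where "complex_of_real s \<odot> ?e \<ominus> ?y \<in> pos V" using order_unit[OF yH] by blast
    then show False using nx mm e x by (simp add: smult_zero minus_eq)
  qed
  then have "wedge (pos V)"
    using pos_hermitian pos_add pos_smult by (simp add: wedge_def)
  then obtain P where P: "wedge P" "?y \<in> P" using wedge_extend[OF _ yH] nx mm by metis
  obtain Q where Q: "wedge Q" "P \<subseteq> Q" "\<And>y. y \<in> hermitian V \<Longrightarrow> y \<in> Q \<or> \<ominus> y \<in> Q"
    using exists_total_wedge[OF P(1)] by metis
  obtain f where f: "f \<in> states V" "\<And>y. y \<in> Q \<Longrightarrow> f y \<in> \<real>\<^sub>\<ge>\<^sub>0"
    using state_of_total_wedge[OF Q(1,3)] by metis
  have "f x \<noteq> 0"
  proof
    assume "f x = 0"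
    \<comment> \<open>If \<open>f x\<close> were zero, the value at \<open>?y\<close> would be
      \<open>-r\<close>, although \<open>?y\<close> lies in the wedge on which \<open>f\<close> is
      nonnegative.\<close>
    have "?y = complex_of_real (- r) \<odot> ?e \<oplus> (-1) \<odot> x"
      by (rule coordinates[OF x ounit_carrier x]) (simp add: algebra_simps)
    then have "f ?y = complex_of_real (- r)"
      using f(1) x \<open>f x = 0\<close> by (simp add: states_def del: of_real_minus)
    moreover have "f ?y \<in> \<real>\<^sub>\<ge>\<^sub>0" using f(2) P(2) Q(2) by blast
    ultimately show False using r by simp
  qed
  then show thesis using f(1) that by blast
qed

end

section \<open>Quotients and the Archimedeanisation\<close>

locale complex_subspace = complex_module M for M :: "(complex, 'a, 'm) module_scheme" (structure) +
  fixes H :: "'a set"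
  assumes subspace_subset: "H \<subseteq> carrier M"
    and subspace_zero: "\<zero> \<in> H"
    and subspace_add: "x \<in> H \<Longrightarrow> y \<in> H \<Longrightarrow> x \<oplus> y \<in> H"
    and subspace_smult: "x \<in> H \<Longrightarrow> c \<odot> x \<in> H"
begin

lemma subspace_carrier: "x \<in> H \<Longrightarrow> x \<in> carrier M"
  using subspace_subset by blast

lemma subspace_uminus: "x \<in> H \<Longrightarrow> \<ominus> x \<in> H"
  by (simp add: minus_eq_smult subspace_carrier subspace_smult)

lemma subspace_minus: "x \<in> H \<Longrightarrow> y \<in> H \<Longrightarrow> x \<ominus> y \<in> H"
  by (simp add: minus_eq subspace_add subspace_uminus)

lemma subspace_subgroup: "subgroup H (add_monoid M)"
proof (rule group.subgroupI[OF M.a_group])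
  fix a assume "a \<in> H"
  then show "inv\<^bsub>add_monoid M\<^esub> a \<in> H" using subspace_uminus by (simp add: a_inv_def)
qed (use subspace_subset subspace_zero subspace_add in auto)

sublocale coset: abelian_subgroup H M
  by (intro abelian_subgroupI3 additive_subgroupI subspace_subgroup M.abelian_group_axioms)

lemma coset_eq_iff:
  assumes "x \<in> carrier M" "y \<in> carrier M"
  shows "H +> x = H +> y \<longleftrightarrow> x \<ominus> y \<in> H"
proof -
  have xy: "x \<oplus> \<ominus> y \<in> carrier M" using assms by simp
  have "H +> x = H +> y \<longleftrightarrow> H +> (x \<oplus> \<ominus> y) = H"
    using M.a_coset_add_inv1[OF _ assms subspace_subset] M.a_coset_add_inv2[OF _ assms subspace_subset]
    by (rule iffI[rotated])
  also have "\<dots> \<longleftrightarrow> x \<oplus> \<ominus> y \<in> H"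
    using M.a_coset_join1[OF _ xy subspace_subgroup] M.a_coset_join2[OF xy subspace_subgroup]
    by (rule iffI)
  finally show ?thesis by (simp only: minus_eq)
qed

lemma quotient_carrier: "carrier (quotient_space M H st P e) = (\<lambda>x. H +> x) ` carrier M"
  by (auto simp: quotient_space_def A_RCOSETS_def')

lemma quotient_zero: "\<zero>\<^bsub>quotient_space M H st P e\<^esub> = H +> \<zero>"
  using subspace_subset by (simp add: quotient_space_def)

lemma quotient_add:
  "x \<in> carrier M \<Longrightarrow> y \<in> carrier M \<Longrightarrow>
    (H +> x) \<oplus>\<^bsub>quotient_space M H st P e\<^esub> (H +> y) = H +> (x \<oplus> y)"
  by (simp add: quotient_space_def coset.a_rcos_sum)

text \<open>The union in \<open>quotient_space\<close> runs over a constant family, since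
  \<open>c (h + x)\<close> and \<open>c x\<close> differ by \<open>c h\<close>, a vector of
  \<open>H\<close>. Cosets are nonempty, so the union equals its common member.\<close>

lemma quotient_smult:
  assumes x: "x \<in> carrier M"
  shows "c \<odot>\<^bsub>quotient_space M H st P e\<^esub> (H +> x) = H +> (c \<odot> x)"
proof -
  have "H +> (c \<odot> y) = H +> (c \<odot> x)" if y: "y \<in> H +> x" for y
  proof -
    obtain h where h: "h \<in> H" "y = h \<oplus> x" using y by (auto simp: a_r_coset_def')
    have hc: "h \<in> carrier M" using h subspace_subset by blast
    have "c \<odot> y \<ominus> c \<odot> x = c \<odot> h"
      unfolding h by (rule coordinates[OF hc x x]) (simp add: algebra_simps)
    then show ?thesis using h hc x subspace_smult by (simp add: coset_eq_iff)
  qed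
  then have "(\<Union>y\<in>H +> x. H +> (c \<odot> y)) = (\<Union>y\<in>H +> x. H +> (c \<odot> x))"
    by (intro SUP_cong refl)
  moreover have "H +> x \<noteq> {}"
    using coset.a_rcos_self[OF x] by (metis empty_iff)
  ultimately show ?thesis by (simp add: quotient_space_def)
qed

text \<open>The additive monoid of the quotient and the library's factor group are different records
  with the same carrier, operation and neutral element. Unfolding the group predicates down to these
  fields transfers the structure.\<close>

lemma quotient_abelian_group: "abelian_group (quotient_space M H st P e)"
proof -
  have "comm_group (add_monoid (quotient_space M H st P e))"
    using coset.a_factorgroup_is_comm_group
    unfolding quotient_space_def A_FactGroup_def' comm_group_def comm_monoid_def
      comm_monoid_axioms_def group_def group_axioms_def monoid_def Units_def
      partial_object.simps monoid.simps ring.simps .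
  then have "comm_group (add_monoid (quotient_space M H st P e))" "comm_monoid (add_monoid (quotient_space M H st P e))"
    by (simp_all only: comm_group.axioms(1))
  then show ?thesis
    by (simp only: abelian_group_def abelian_group_axioms_def abelian_monoid_def simp_thms)
qed

lemma quotient_module: "module (ring_of_type_algebra :: complex ring) (quotient_space M H st P e)"
proof -
  let ?Q = "quotient_space M H st P e"
  have "module_axioms (ring_of_type_algebra :: complex ring) ?Q"
    by (rule module_axioms.intro; unfold quotient_carrier; (elim imageE)?)
       (simp_all add: quotient_add quotient_smult ring_of_type_algebra_def
         smult_add_left smult_add_right smult_smult smult_1)
  then show ?thesis
    by (intro module.intro cring_from_type_algebra quotient_abelian_group)
qed

text \<open>The function \<open>s\<close> lifts the involution to representatives. It is a parameter
  because \<open>M\<close> is only a module: the sequence space has no field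
  \<open>star\<close>.\<close>

lemma quotient_star_vector_space:
  assumes closed: "\<And>x. x \<in> carrier M \<Longrightarrow> s x \<in> carrier M"
    and "\<And>x. x \<in> carrier M \<Longrightarrow> s (s x) = x"
    and "\<And>x y. x \<in> carrier M \<Longrightarrow> y \<in> carrier M \<Longrightarrow> s (x \<oplus> y) = s x \<oplus> s y"
    and "\<And>c x. x \<in> carrier M \<Longrightarrow> s (c \<odot> x) = cnj c \<odot> s x"
    and st: "\<And>x. x \<in> carrier M \<Longrightarrow> st (H +> x) = H +> s x"
  shows "star_vector_space (quotient_space M H st P e)"
proof -
  have star: "star (quotient_space M H st P e) = st" by (simp add: quotient_space_def)
  show ?thesis
    by (intro star_vector_space.intro quotient_module star_vector_space_axioms.intro)
       (use assms in \<open>auto simp: quotient_carrier quotient_add quotient_smult star\<close>)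
qed

end

section \<open>The common kernel of the states and the Archimedean closure of the cone\<close>

context order_unit_space
begin

lemma state_add:
  "f \<in> states V \<Longrightarrow> x \<in> carrier V \<Longrightarrow> y \<in> carrier V \<Longrightarrow> f (x \<oplus> y) = f x + f y"
  by (simp add: states_def)

lemma state_smult: "f \<in> states V \<Longrightarrow> x \<in> carrier V \<Longrightarrow> f (c \<odot> x) = c * f x"
  by (simp add: states_def)

lemma state_zero:
  assumes "f \<in> states V" shows "f \<zero> = 0"
proof -
  have "f (0 \<odot> \<zero>) = 0 * f \<zero>" using assms by (simp only: states_def mem_Collect_eq M.zero_closed)
  then show ?thesis by (simp add: smult_zero)
qed

lemma state_nullD: "x \<in> state_null V \<Longrightarrow> f \<in> states V \<Longrightarrow> f x = 0"
  unfolding state_null_def by blast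

lemma state_nullI: "x \<in> carrier V \<Longrightarrow> (\<And>f. f \<in> states V \<Longrightarrow> f x = 0) \<Longrightarrow> x \<in> state_null V"
  unfolding state_null_def by blast

lemma state_null_subspace: "complex_subspace V (state_null V)"
proof
  show "state_null V \<subseteq> carrier V" by (auto simp: state_null_def)
  then have c: "x \<in> carrier V" if "x \<in> state_null V" for x using that by blast
  show "\<zero> \<in> state_null V" by (rule state_nullI) (simp_all add: state_zero)
  fix x assume x: "x \<in> state_null V"
  show "c \<odot> x \<in> state_null V" for c
    by (rule state_nullI) (simp_all add: c[OF x] state_smult state_nullD[OF x])
  show "x \<oplus> y \<in> state_null V" if y: "y \<in> state_null V" for y
    by (rule state_nullI) (simp_all add: c[OF x] c[OF y] state_add state_nullD[OF x] state_nullD[OF y])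
qed

text \<open>For a state \<open>f\<close>, the functional sending \<open>y\<close> to
  \<open>cnj (f (star V y))\<close> is a state as well: positive vectors are fixed by the involution
  and have real values. Evaluating it at \<open>x\<close> gives the claim.\<close>

lemma state_null_star:
  assumes "x \<in> state_null V" shows "star V x \<in> state_null V"
proof (rule state_nullI)
  show "star V x \<in> carrier V" using assms by (simp add: state_null_def star_closed)
  fix f assume f: "f \<in> states V"
  have "(\<lambda>y. cnj (f (star V y))) \<in> states V"
    using f pos_hermitian ounit_hermitian
    by (fastforce simp: states_def star_add star_smult star_closed hermitian_def
        nonneg_Reals_def image_subset_iff)
  from state_nullD[OF assms this] show "f (star V x) = 0" by simp
qed

text \<open>The Archimedean closure of the cone, formed before passing to the quotient. Its body is
  the right-hand side of the Archimedean axiom, so that axiom says that \<open>arch_cone\<close> is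
  \<open>pos V\<close>.\<close>

definition arch_cone :: "'a set" where
  "arch_cone = {x \<in> hermitian V. \<forall>r>0. complex_of_real r \<odot> ounit V \<oplus> x \<in> pos V}"

lemma arch_cone_carrier: "x \<in> arch_cone \<Longrightarrow> x \<in> carrier V"
  by (simp add: arch_cone_def hermitian_carrier)

text \<open>The existence of states enters the Archimedeanisation through this contrapositive of
  \<open>exists_state_nonzero\<close>.\<close>

lemma state_null_arch_cone:
  assumes x: "x \<in> state_null V" "x \<in> hermitian V" shows "x \<in> arch_cone"
  unfolding arch_cone_def
proof (intro CollectI conjI allI impI x(2))
  fix r :: real assume r: "0 < r"
  show "complex_of_real r \<odot> ounit V \<oplus> x \<in> pos V"
  proof (rule ccontr)
    assume "complex_of_real r \<odot> ounit V \<oplus> x \<notin> pos V"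
    then obtain f where "f \<in> states V" "f x \<noteq> 0" by (rule exists_state_nonzero[OF x(2) r])
    then show False using state_nullD[OF x(1)] by blast
  qed
qed

text \<open>Closing the cone a second time adds nothing: half of \<open>r\<close> is spent on each
  closure. This becomes the Archimedean axiom of the quotient.\<close>

lemma arch_coneI:
  assumes "x \<in> hermitian V"
    and "\<And>r. 0 < r \<Longrightarrow> complex_of_real r \<odot> ounit V \<oplus> x \<in> arch_cone"
  shows "x \<in> arch_cone"
  unfolding arch_cone_def
proof (intro CollectI conjI allI impI)
  fix r :: real assume "0 < r"
  then obtain s where s: "r = s + s" "0 < s" by (metis field_sum_of_halves half_gt_zero)
  have x: "x \<in> carrier V" using assms(1) by (rule hermitian_carrier)
  have "complex_of_real r \<odot> ounit V \<oplus> x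
      = complex_of_real s \<odot> ounit V \<oplus> (complex_of_real s \<odot> ounit V \<oplus> x)"
    unfolding s by (rule coordinates[OF x ounit_carrier x]) simp
  also have "\<dots> \<in> pos V" using assms(2)[OF s(2)] s(2) by (simp add: arch_cone_def)
  finally show "complex_of_real r \<odot> ounit V \<oplus> x \<in> pos V" .
qed (fact assms(1))

lemma pos_arch_cone: "x \<in> pos V \<Longrightarrow> x \<in> arch_cone"
  unfolding arch_cone_def
  using pos_hermitian pos_add[OF pos_smult[OF _ ounit_pos]] by (simp add: subset_iff)

lemma arch_cone_add:
  assumes "x \<in> arch_cone" "y \<in> arch_cone" shows "x \<oplus> y \<in> arch_cone"
  unfolding arch_cone_def
proof (intro CollectI conjI allI impI)
  show "x \<oplus> y \<in> hermitian V" using assms by (simp add: arch_cone_def hermitian_add)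
  fix r :: real assume "0 < r"
  then obtain s where s: "r = s + s" "0 < s" by (metis field_sum_of_halves half_gt_zero)
  have "complex_of_real r \<odot> ounit V \<oplus> (x \<oplus> y)
      = (complex_of_real s \<odot> ounit V \<oplus> x) \<oplus> (complex_of_real s \<odot> ounit V \<oplus> y)"
    unfolding s
    by (rule coordinates[OF arch_cone_carrier[OF assms(1)] ounit_carrier arch_cone_carrier[OF assms(2)]])
       simp
  also have "\<dots> \<in> pos V"
    by (rule pos_add) (use assms s in \<open>simp_all add: arch_cone_def\<close>)
  finally show "complex_of_real r \<odot> ounit V \<oplus> (x \<oplus> y) \<in> pos V" .
qed

text \<open>Slack \<open>r\<close> for \<open>t x\<close> is \<open>t\<close> times slack
  \<open>r / t\<close> for \<open>x\<close>; the factor zero needs its own case.\<close>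

lemma arch_cone_smult:
  assumes x: "x \<in> arch_cone" and t: "0 \<le> t" shows "complex_of_real t \<odot> x \<in> arch_cone"
proof (cases "t = 0")
  case True
  then show ?thesis using pos_arch_cone[OF pos_zero] arch_cone_carrier[OF x] by (simp add: smult_0)
next
  case False
  show ?thesis
    unfolding arch_cone_def
  proof (intro CollectI conjI allI impI)
    show "complex_of_real t \<odot> x \<in> hermitian V" using x by (simp add: arch_cone_def hermitian_smult)
    fix r :: real assume r: "0 < r"
    have "complex_of_real r \<odot> ounit V \<oplus> complex_of_real t \<odot> x
        = complex_of_real t \<odot> (complex_of_real (r/t) \<odot> ounit V \<oplus> x)"
      by (rule coordinates[OF arch_cone_carrier[OF x] ounit_carrier ounit_carrier])
         (use False in simp)
    also have "\<dots> \<in> pos V"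
      by (rule pos_smult[OF t]) (use x r t False in \<open>simp add: arch_cone_def del: of_real_divide\<close>)
    finally show "complex_of_real r \<odot> ounit V \<oplus> complex_of_real t \<odot> x \<in> pos V" .
  qed
qed

text \<open>Each \<open>r + f x\<close> with \<open>r > 0\<close> is real and nonnegative. The value
  \<open>r = 1\<close> makes \<open>f x\<close> real, and letting \<open>r\<close> tend to 0 makes
  it nonnegative.\<close>

lemma state_arch_cone:
  assumes x: "x \<in> arch_cone" and f: "f \<in> states V" shows "f x \<in> \<real>\<^sub>\<ge>\<^sub>0"
proof -
  have *: "complex_of_real r + f x \<in> \<real>\<^sub>\<ge>\<^sub>0" if r: "0 < r" for r
  proof -
    have "complex_of_real r \<odot> ounit V \<oplus> x \<in> pos V" using x r by (simp add: arch_cone_def)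
    moreover have "f ` pos V \<subseteq> \<real>\<^sub>\<ge>\<^sub>0" "f (ounit V) = 1" using f by (simp_all add: states_def)
    ultimately show ?thesis
      using arch_cone_carrier[OF x] by (auto simp: image_subset_iff state_add[OF f] state_smult[OF f])
  qed
  have "Im (f x) = 0" using *[of 1] by (simp add: complex_nonneg_Reals_iff)
  moreover have "0 \<le> Re (f x)"
  proof (rule field_le_epsilon)
    fix r :: real assume "0 < r"
    from *[OF this] show "0 \<le> Re (f x) + r" by (simp add: complex_nonneg_Reals_iff)
  qed
  ultimately show ?thesis by (simp add: complex_nonneg_Reals_iff)
qed

text \<open>The involution and the cone are prescribed only by their effect on cosets, so that the
  formulas in the construction can be substituted later. Properness of the quotient cone comes from
  defining the kernel by states, and the Archimedean axiom from \<open>arch_coneI\<close>.\<close>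

theorem archimedeanisation_aou_space:
  fixes st P
  defines "N \<equiv> state_null V"
  defines "W \<equiv> quotient_space V N st P (N +> ounit V)"
  assumes st: "\<And>x. x \<in> carrier V \<Longrightarrow> st (N +> x) = N +> star V x"
    and P: "P = (\<lambda>x. N +> x) ` arch_cone"
  shows "aou_space W"
proof -
  interpret N: complex_subspace V N unfolding N_def by (rule state_null_subspace)
  interpret W: star_vector_space W
    unfolding W_def
    by (rule N.quotient_star_vector_space[of "star V"]) (use st in \<open>auto simp: star_closed star_star star_add star_smult\<close>)
  note quot = N.quotient_carrier[where st = st and P = P and e = "N +> ounit V", folded W_def]
    N.quotient_zero[where st = st and P = P and e = "N +> ounit V", folded W_def]
    N.quotient_add[where st = st and P = P and e = "N +> ounit V", folded W_def]
    N.quotient_smult[where st = st and P = P and e = "N +> ounit V", folded W_def]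
  have qminus: "\<ominus>\<^bsub>W\<^esub> (N +> x) = N +> \<ominus> x" if "x \<in> carrier V" for x
    using that by (simp add: W.minus_eq_smult minus_eq_smult quot)
  have qdiff: "(N +> x) \<ominus>\<^bsub>W\<^esub> (N +> y) = N +> (x \<ominus> y)" if "x \<in> carrier V" "y \<in> carrier V" for x y
    using that by (simp add: W.minus_eq minus_eq qminus quot)
  have posW: "pos W = (\<lambda>x. N +> x) ` arch_cone" and starW: "star W = st"
    and unitW: "ounit W = N +> ounit V"
    by (simp_all add: W_def quotient_space_def P)
  \<comment> \<open>A hermitian coset has a hermitian representative: \<open>x - re_part x\<close>
    is half of \<open>x - star V x\<close>, which lies in \<open>N\<close>.\<close>
  have herm: "\<exists>x\<in>hermitian V. C = N +> x" if C: "C \<in> hermitian W" for C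
  proof -
    obtain x where x: "x \<in> carrier V" "C = N +> x" using C by (auto simp: hermitian_def quot)
    have "N +> star V x = N +> x" using C x st by (simp add: hermitian_def starW)
    then have "x \<ominus> star V x \<in> N" using x by (metis N.coset_eq_iff star_closed)
    then have "(1/2) \<odot> (x \<ominus> star V x) \<in> N" by (rule N.subspace_smult)
    also have "(1/2) \<odot> (x \<ominus> star V x) = x \<ominus> re_part x"
      unfolding re_part_def by (rule coordinates[OF x(1) star_closed[OF x(1)] x(1)]) simp
    finally have "C = N +> re_part x"
      using x re_part_hermitian[OF x(1)] by (simp add: N.coset_eq_iff hermitian_carrier)
    then show ?thesis using re_part_hermitian[OF x(1)] by blast
  qed
  have hermI: "N +> x \<in> hermitian W" if "x \<in> hermitian V" for x
    using that st by (simp add: hermitian_def starW quot)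
  \<comment> \<open>Membership in the cone does not depend on the hermitian representative, because
    a hermitian difference in \<open>N\<close> lies in \<open>arch_cone\<close> and can be
    added.\<close>
  have pos_iff: "N +> x \<in> pos W \<longleftrightarrow> x \<in> arch_cone" if xH: "x \<in> hermitian V" for x
  proof
    assume "N +> x \<in> pos W"
    then obtain y where y: "y \<in> arch_cone" "N +> x = N +> y" by (auto simp: posW)
    have xc: "x \<in> carrier V" and yc: "y \<in> carrier V" and yH: "y \<in> hermitian V"
      using xH y by (auto simp: hermitian_carrier arch_cone_def)
    have "x \<ominus> y \<in> N" using y xc yc by (simp add: N.coset_eq_iff)
    then have "x \<ominus> y \<in> arch_cone"
      using xH yH by (simp add: N_def state_null_arch_cone hermitian_minus)
    then have "(x \<ominus> y) \<oplus> y \<in> arch_cone" using y by (intro arch_cone_add)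
    also have "(x \<ominus> y) \<oplus> y = x" by (rule coordinates[OF xc yc xc]) simp
    finally show "x \<in> arch_cone" .
  qed (simp add: posW)
  show ?thesis
  proof
    show "pos W \<subseteq> hermitian W" by (auto simp: posW arch_cone_def intro: hermI)
    show "\<zero>\<^bsub>W\<^esub> \<in> pos W" using pos_arch_cone[OF pos_zero] by (simp add: posW quot)
    show "x \<oplus>\<^bsub>W\<^esub> y \<in> pos W" if "x \<in> pos W" "y \<in> pos W" for x y
      using that by (auto simp: posW quot arch_cone_carrier intro: arch_cone_add)
    show "complex_of_real r \<odot>\<^bsub>W\<^esub> x \<in> pos W" if "0 \<le> r" "x \<in> pos W" for x r
      using that by (auto simp: posW quot arch_cone_carrier intro: arch_cone_smult)
    \<comment> \<open>A state has nonnegative values on \<open>x\<close> and \<open>y\<close> that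
      sum to zero, since \<open>x + y\<close> lies in \<open>N\<close>. Both values vanish, so
      \<open>x\<close> lies in \<open>N\<close>.\<close>
    have proper: "N +> x = \<zero>\<^bsub>W\<^esub>" if x: "x \<in> arch_cone" and y: "y \<in> arch_cone" and xy: "N +> x = \<ominus>\<^bsub>W\<^esub> (N +> y)" for x y
    proof -
      have xc: "x \<in> carrier V" and yc: "y \<in> carrier V" using x y by (auto simp: arch_cone_carrier)
      have "x \<ominus> \<ominus> y \<in> N" using xy xc yc by (simp add: qminus N.coset_eq_iff)
      then have N: "x \<oplus> y \<in> N" using xc yc by (simp add: minus_eq)
      have "f x = 0" if f: "f \<in> states V" for f
      proof -
        have "f (x \<oplus> y) = 0" using state_nullD[OF N[unfolded N_def] f] .
        then have "f x + f y = 0" using f xc yc by (simp add: states_def)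
        then show ?thesis
          using state_arch_cone[OF x f] state_arch_cone[OF y f]
          by (simp add: complex_nonneg_Reals_iff complex_eq_iff)
      qed
      then have "x \<in> N" unfolding N_def by (rule state_nullI[OF xc])
      then have "x \<ominus> \<zero> \<in> N" using xc by (simp add: minus_eq)
      then show ?thesis using xc by (simp add: quot N.coset_eq_iff)
    qed
    show "pos W \<inter> {\<ominus>\<^bsub>W\<^esub> x |x. x \<in> pos W} = {\<zero>\<^bsub>W\<^esub>}"
    proof (rule equalityI; rule subsetI)
      fix C assume C: "C \<in> pos W \<inter> {\<ominus>\<^bsub>W\<^esub> x |x. x \<in> pos W}"
      obtain x where x: "x \<in> arch_cone" "C = N +> x" using C unfolding posW by blast
      obtain y where y: "y \<in> arch_cone" "C = \<ominus>\<^bsub>W\<^esub> (N +> y)" using C unfolding posW by blast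
      show "C \<in> {\<zero>\<^bsub>W\<^esub>}" using proper[OF x(1) y(1)] x(2) y(2) by simp
    next
      fix C assume "C \<in> {\<zero>\<^bsub>W\<^esub>}"
      then have "C = \<zero>\<^bsub>W\<^esub>" by (rule singletonD)
      moreover have "\<zero>\<^bsub>W\<^esub> = \<ominus>\<^bsub>W\<^esub> \<zero>\<^bsub>W\<^esub>"
        by (rule sym, rule trans[OF W.minus_eq_smult[OF W.M.zero_closed] W.smult_zero])
      moreover have "\<zero>\<^bsub>W\<^esub> \<in> pos W" using pos_arch_cone[OF pos_zero] by (simp add: posW quot)
      ultimately show "C \<in> pos W \<inter> {\<ominus>\<^bsub>W\<^esub> x |x. x \<in> pos W}" by blast
    qed
    show "ounit W \<in> pos W" using pos_arch_cone[OF ounit_pos] by (simp add: posW unitW)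
    show "\<exists>r>0. complex_of_real r \<odot>\<^bsub>W\<^esub> ounit W \<ominus>\<^bsub>W\<^esub> C \<in> pos W" if C: "C \<in> hermitian W" for C
    proof -
      obtain x where x: "x \<in> hermitian V" "C = N +> x" using herm[OF C] by blast
      obtain r where r: "0 < r" "complex_of_real r \<odot> ounit V \<ominus> x \<in> pos V"
        using order_unit[OF x(1)] by blast
      have "complex_of_real r \<odot>\<^bsub>W\<^esub> ounit W \<ominus>\<^bsub>W\<^esub> C = N +> (complex_of_real r \<odot> ounit V \<ominus> x)"
        using x hermitian_carrier[OF x(1)] by (simp add: unitW quot qdiff)
      then show ?thesis using r pos_arch_cone[OF r(2)] by (auto simp: posW)
    qed
    show "pos W = {C \<in> hermitian W. \<forall>r>0. complex_of_real r \<odot>\<^bsub>W\<^esub> ounit W \<oplus>\<^bsub>W\<^esub> C \<in> pos W}" (is "_ = ?R")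
    proof
      show "pos W \<subseteq> ?R"
      proof (rule subsetI, intro CollectI conjI allI impI)
        fix C assume "C \<in> pos W"
        then obtain x where x: "x \<in> arch_cone" "C = N +> x" unfolding posW by blast
        then show "C \<in> hermitian W" using hermI by (simp add: arch_cone_def)
        fix r :: real assume "0 < r"
        then have "complex_of_real r \<odot> ounit V \<oplus> x \<in> arch_cone"
          by (intro arch_cone_add[OF pos_arch_cone[OF pos_smult[OF _ ounit_pos]] x(1)]) simp
        then show "complex_of_real r \<odot>\<^bsub>W\<^esub> ounit W \<oplus>\<^bsub>W\<^esub> C \<in> pos W"
          using x by (simp add: posW unitW quot arch_cone_carrier)
      qed
      show "?R \<subseteq> pos W"
      proof
        fix C assume C: "C \<in> ?R"
        then obtain x where x: "x \<in> hermitian V" "C = N +> x" using herm by blast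
        have "x \<in> arch_cone"
        proof (rule arch_coneI[OF x(1)])
          fix r :: real assume "0 < r"
          then have "N +> (complex_of_real r \<odot> ounit V \<oplus> x) \<in> pos W"
            using C x hermitian_carrier[OF x(1)] by (auto simp: unitW quot)
          then show "complex_of_real r \<odot> ounit V \<oplus> x \<in> arch_cone"
            using x by (simp add: pos_iff hermitian_add hermitian_smult ounit_hermitian)
        qed
        then show "C \<in> pos W" using x by (simp add: posW)
      qed
    qed
  qed
qed

end

section \<open>Unital positive maps and their factorisation through the Archimedeanisation\<close>

lemma (in aou_space) arch_cone_eq_pos: "arch_cone = pos V"
  unfolding arch_cone_def by (rule archimedean[symmetric])

text \<open>Neither space is assumed Archimedean, so that maps out of the algebraic colimit are
  covered.\<close>

locale aou_morphism = V: order_unit_space V + W: order_unit_space W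
  for V :: "('a, 'm) star_ou_space_scheme" and W :: "('b, 'n) star_ou_space_scheme" +
  fixes f :: "'a \<Rightarrow> 'b"
  assumes hom: "aou_hom V W f"
begin

lemma closed: "x \<in> carrier V \<Longrightarrow> f x \<in> carrier W"
  and add: "x \<in> carrier V \<Longrightarrow> y \<in> carrier V \<Longrightarrow> f (x \<oplus>\<^bsub>V\<^esub> y) = f x \<oplus>\<^bsub>W\<^esub> f y"
  and smult: "x \<in> carrier V \<Longrightarrow> f (c \<odot>\<^bsub>V\<^esub> x) = c \<odot>\<^bsub>W\<^esub> f x"
  and pos: "x \<in> pos V \<Longrightarrow> f x \<in> pos W"
  and unit: "f (ounit V) = ounit W"
  using hom by (auto simp: aou_hom_def)

lemma zero: "f \<zero>\<^bsub>V\<^esub> = \<zero>\<^bsub>W\<^esub>"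
  using smult[of "\<zero>\<^bsub>V\<^esub>" 0] closed[of "\<zero>\<^bsub>V\<^esub>"] by (simp add: V.smult_0 W.smult_0)

lemma uminus: "x \<in> carrier V \<Longrightarrow> f (\<ominus>\<^bsub>V\<^esub> x) = \<ominus>\<^bsub>W\<^esub> f x"
  by (simp add: V.minus_eq_smult W.minus_eq_smult smult closed)

lemma minus: "x \<in> carrier V \<Longrightarrow> y \<in> carrier V \<Longrightarrow> f (x \<ominus>\<^bsub>V\<^esub> y) = f x \<ominus>\<^bsub>W\<^esub> f y"
  by (simp add: V.minus_eq W.minus_eq add uminus)

text \<open>\<open>aou_hom\<close> does not mention the involution. For large \<open>r\<close> the
  vector \<open>r e - x\<close> is positive, so its image is hermitian, and \<open>f x\<close> is
  the difference of \<open>r e\<close> and this image.\<close>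

lemma hermitian:
  assumes x: "x \<in> hermitian V" shows "f x \<in> hermitian W"
proof -
  have xc: "x \<in> carrier V" using x by (rule V.hermitian_carrier)
  obtain r where r: "complex_of_real r \<odot>\<^bsub>V\<^esub> ounit V \<ominus>\<^bsub>V\<^esub> x \<in> pos V" using V.order_unit[OF x] by blast
  have "f (complex_of_real r \<odot>\<^bsub>V\<^esub> ounit V \<ominus>\<^bsub>V\<^esub> x) = complex_of_real r \<odot>\<^bsub>W\<^esub> ounit W \<ominus>\<^bsub>W\<^esub> f x"
    using xc by (simp add: minus smult unit)
  then have "complex_of_real r \<odot>\<^bsub>W\<^esub> ounit W \<ominus>\<^bsub>W\<^esub> f x \<in> hermitian W"
    using pos[OF r] W.pos_hermitian by auto
  then have "complex_of_real r \<odot>\<^bsub>W\<^esub> ounit W \<ominus>\<^bsub>W\<^esub> (complex_of_real r \<odot>\<^bsub>W\<^esub> ounit W \<ominus>\<^bsub>W\<^esub> f x) \<in> hermitian W"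
    by (rule W.hermitian_minus[OF W.hermitian_smult[OF W.ounit_hermitian]])
  also have "complex_of_real r \<odot>\<^bsub>W\<^esub> ounit W \<ominus>\<^bsub>W\<^esub> (complex_of_real r \<odot>\<^bsub>W\<^esub> ounit W \<ominus>\<^bsub>W\<^esub> f x) = f x"
    by (rule W.coordinates[OF closed[OF xc] W.ounit_carrier W.ounit_carrier]) simp
  finally show ?thesis .
qed

text \<open>Both sides agree on the hermitian parts of \<open>x\<close>, whose images are again
  hermitian; linearity does the rest.\<close>

lemma star:
  assumes x: "x \<in> carrier V" shows "f (star V x) = star W (f x)"
proof -
  let ?a = "V.re_part x" and ?b = "V.im_part x"
  have ab: "?a \<in> hermitian V" "?b \<in> hermitian V"
    using x by (auto intro: V.re_part_hermitian V.im_part_hermitian)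
  note c = ab[THEN V.hermitian_carrier] and h = ab[THEN hermitian]
  have "f (star V (?a \<oplus>\<^bsub>V\<^esub> \<i> \<odot>\<^bsub>V\<^esub> ?b)) = star W (f (?a \<oplus>\<^bsub>V\<^esub> \<i> \<odot>\<^bsub>V\<^esub> ?b))"
    using ab c h by (simp add: V.star_add V.star_smult W.star_add W.star_smult add smult closed hermitian_def)
  then show ?thesis using V.re_im_parts[OF x] by simp
qed

lemma arch_cone: "x \<in> V.arch_cone \<Longrightarrow> f x \<in> W.arch_cone"
  unfolding W.arch_cone_def
proof (intro CollectI conjI allI impI)
  assume x: "x \<in> V.arch_cone"
  then show "f x \<in> hermitian W" by (simp add: V.arch_cone_def hermitian)
  fix r :: real assume "0 < r"
  then have "f (complex_of_real r \<odot>\<^bsub>V\<^esub> ounit V \<oplus>\<^bsub>V\<^esub> x) \<in> pos W"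
    using x by (intro pos) (simp add: V.arch_cone_def)
  then show "complex_of_real r \<odot>\<^bsub>W\<^esub> ounit W \<oplus>\<^bsub>W\<^esub> f x \<in> pos W"
    using V.arch_cone_carrier[OF x] by (simp add: add smult unit)
qed

end

locale aou_morphism_to_aou = aou_morphism V W f + W: aou_space W
  for V :: "('a, 'm) star_ou_space_scheme" and W :: "('b, 'n) star_ou_space_scheme" and f
begin

text \<open>The perturbation by \<open>r e\<close> passes through the unital map, and the
  Archimedean axiom of the target then removes it.\<close>

lemma arch_cone_pos: "x \<in> V.arch_cone \<Longrightarrow> f x \<in> pos W"
  unfolding W.arch_cone_eq_pos[symmetric] by (rule arch_cone)

lemma state_null_hermitian:
  assumes "x \<in> state_null V" "x \<in> hermitian V" shows "f x = \<zero>\<^bsub>W\<^esub>"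
proof (rule W.pos_antisym)
  interpret N: complex_subspace V "state_null V" by (rule V.state_null_subspace)
  have x: "x \<in> carrier V" using assms by (auto simp: hermitian_def)
  show "f x \<in> pos W" using assms by (intro arch_cone_pos V.state_null_arch_cone)
  have "\<ominus>\<^bsub>V\<^esub> x \<in> state_null V" using N.subspace_smult[OF assms(1), of "-1"] x by (simp add: V.minus_eq_smult)
  then have "f (\<ominus>\<^bsub>V\<^esub> x) \<in> pos W"
    using assms by (intro arch_cone_pos V.state_null_arch_cone V.hermitian_uminus)
  then show "\<ominus>\<^bsub>W\<^esub> f x \<in> pos W" using x by (simp add: uminus)
qed

text \<open>Invariance of the kernel under the involution puts both hermitian parts of
  \<open>x\<close> into it, which reduces the claim to hermitian vectors.\<close>

lemma state_null:
  assumes "x \<in> state_null V" shows "f x = \<zero>\<^bsub>W\<^esub>"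
proof -
  interpret N: complex_subspace V "state_null V" by (rule V.state_null_subspace)
  have x: "x \<in> carrier V" using assms N.subspace_subset by blast
  have "V.re_part x \<in> state_null V" "V.im_part x \<in> state_null V"
    unfolding V.re_part_def V.im_part_def
    using assms V.state_null_star by (auto intro!: N.subspace_smult N.subspace_add N.subspace_minus)
  then have "f (V.re_part x) = \<zero>\<^bsub>W\<^esub>" "f (V.im_part x) = \<zero>\<^bsub>W\<^esub>"
    using x by (auto intro: state_null_hermitian V.re_part_hermitian V.im_part_hermitian)
  moreover have "f x = f (V.re_part x) \<oplus>\<^bsub>W\<^esub> \<i> \<odot>\<^bsub>W\<^esub> f (V.im_part x)"
    using V.re_im_parts[OF x] x V.re_part_hermitian V.im_part_hermitian V.hermitian_carrier
    by (metis add smult V.smult_mem)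
  ultimately show ?thesis by (simp add: W.smult_zero)
qed

theorem archimedeanisation_universal:
  fixes st
  defines "N \<equiv> state_null V"
  defines "L \<equiv> quotient_space V N st ((\<lambda>x. N +>\<^bsub>V\<^esub> x) ` V.arch_cone) (N +>\<^bsub>V\<^esub> ounit V)"
  obtains g where "aou_hom L W g" "\<And>x. x \<in> carrier V \<Longrightarrow> g (N +>\<^bsub>V\<^esub> x) = f x"
proof
  interpret N: complex_subspace V N unfolding N_def by (rule V.state_null_subspace)
  \<comment> \<open>A representative is chosen arbitrarily; two choices differ by a vector of
    \<open>N\<close>, which \<open>f\<close> kills.\<close>
  define g where "g C = f (SOME x. x \<in> carrier V \<and> N +>\<^bsub>V\<^esub> x = C)" for C
  show g: "g (N +>\<^bsub>V\<^esub> x) = f x" if x: "x \<in> carrier V" for x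
  proof -
    define y where "y = (SOME y. y \<in> carrier V \<and> N +>\<^bsub>V\<^esub> y = N +>\<^bsub>V\<^esub> x)"
    have y: "y \<in> carrier V \<and> N +>\<^bsub>V\<^esub> y = N +>\<^bsub>V\<^esub> x" unfolding y_def by (rule someI[of _ x]) (use x in simp)
    then have "y \<ominus>\<^bsub>V\<^esub> x \<in> N" using x N.coset_eq_iff[of y x] by simp
    then have "y \<ominus>\<^bsub>V\<^esub> x \<in> state_null V" by (simp only: N_def)
    then have "f y \<ominus>\<^bsub>W\<^esub> f x = \<zero>\<^bsub>W\<^esub>" using x y state_null by (simp add: minus[symmetric])
    moreover have "f y = f x \<oplus>\<^bsub>W\<^esub> (f y \<ominus>\<^bsub>W\<^esub> f x)"
      by (rule W.coordinates[OF closed[OF x] closed[OF conjunct1[OF y]] closed[OF x]]) simp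
    ultimately have "f y = f x" using closed[OF x] by simp
    then show ?thesis by (simp add: g_def y_def)
  qed
  have *: "carrier L = (\<lambda>x. N +>\<^bsub>V\<^esub> x) ` carrier V" "pos L = (\<lambda>x. N +>\<^bsub>V\<^esub> x) ` V.arch_cone"
    "ounit L = N +>\<^bsub>V\<^esub> ounit V"
    by (simp_all add: L_def N.quotient_carrier) (simp_all add: quotient_space_def)
  show "aou_hom L W g"
    unfolding aou_hom_def * using arch_cone_pos
    by (auto simp: L_def N.quotient_add N.quotient_smult g closed add smult unit V.arch_cone_carrier)
qed

end

section \<open>The inductive limit\<close>

lemma phi_to_same [simp]: "phi_to \<phi> k k x = x"
  by (simp add: phi_to_def)

lemma phi_to_Suc: "k \<le> l \<Longrightarrow> phi_to \<phi> k (Suc l) x = \<phi> l (phi_to \<phi> k l x)"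
  by (simp add: phi_to_def)

lemma phi_to_trans:
  assumes "k \<le> l" "l \<le> m" shows "phi_to \<phi> l m (phi_to \<phi> k l x) = phi_to \<phi> k m x"
  using assms(2,1) by (induction m rule: dec_induct) (simp_all add: phi_to_Suc)

locale aou_system =
  fixes V :: "nat \<Rightarrow> 'a star_ou_space" and \<phi> :: "nat \<Rightarrow> 'a \<Rightarrow> 'a"
  assumes aou: "aou_space (V k)"
    and hom: "aou_hom (V k) (V (Suc k)) (\<phi> k)"

sublocale aou_system \<subseteq> V: aou_space "V k" for k
  by (rule aou)

sublocale aou_system \<subseteq> \<phi>: aou_morphism "V k" "V (Suc k)" "\<phi> k" for k
  by unfold_locales (rule hom)

context aou_system
begin

abbreviation "S \<equiv> seq_space V \<phi>"
abbreviation "Z \<equiv> null_seqs V \<phi>"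
abbreviation "W \<equiv> V_ddot V \<phi>"

text \<open>Once composites are known to be morphisms, their compatibility with involution and
  negation follows without further inductions.\<close>

lemma phi_to_morphism:
  assumes "k \<le> l" shows "aou_morphism (V k) (V l) (phi_to \<phi> k l)"
proof -
  have "aou_hom (V k) (V l) (phi_to \<phi> k l)"
    using assms
  proof (induction l rule: dec_induct)
    case base
    show ?case by (auto simp: aou_hom_def)
  next
    case (step l)
    then interpret I: aou_morphism "V k" "V l" "phi_to \<phi> k l" by unfold_locales
    show ?case
      unfolding aou_hom_def using step(1)
      by (simp add: phi_to_Suc I.closed \<phi>.closed I.add \<phi>.add I.smult \<phi>.smult I.pos \<phi>.pos
          I.unit \<phi>.unit image_subset_iff)
  qed
  then show ?thesis by unfold_locales
qed

lemmas phi_to_closed = aou_morphism.closed[OF phi_to_morphism]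
lemmas phi_to_add = aou_morphism.add[OF phi_to_morphism]
lemmas phi_to_smult = aou_morphism.smult[OF phi_to_morphism]
lemmas phi_to_pos = aou_morphism.pos[OF phi_to_morphism]
lemmas phi_to_unit = aou_morphism.unit[OF phi_to_morphism]
lemmas phi_to_star = aou_morphism.star[OF phi_to_morphism]
lemmas phi_to_uminus = aou_morphism.uminus[OF phi_to_morphism]

lemma seq_simps:
  "\<zero>\<^bsub>S\<^esub> = (\<lambda>k. \<zero>\<^bsub>V k\<^esub>)" "x \<oplus>\<^bsub>S\<^esub> y = (\<lambda>k. x k \<oplus>\<^bsub>V k\<^esub> y k)" "c \<odot>\<^bsub>S\<^esub> x = (\<lambda>k. c \<odot>\<^bsub>V k\<^esub> x k)"
  by (simp_all add: seq_space_def)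

lemma seq_carrierI:
  "(\<And>k. x k \<in> carrier (V k)) \<Longrightarrow> (\<And>k. m \<le> k \<Longrightarrow> \<phi> k (x k) = x (Suc k)) \<Longrightarrow> x \<in> carrier S"
  unfolding seq_space_def by auto

lemma seq_closed: "x \<in> carrier S \<Longrightarrow> x k \<in> carrier (V k)"
  unfolding seq_space_def by auto

lemma seq_coherent:
  assumes "x \<in> carrier S" obtains m where "\<And>k. m \<le> k \<Longrightarrow> \<phi> k (x k) = x (Suc k)"
  using assms unfolding seq_space_def by auto

lemma seq_zero_closed: "(\<lambda>k. \<zero>\<^bsub>V k\<^esub>) \<in> carrier S"
  by (rule seq_carrierI) (simp_all add: \<phi>.zero)

lemma seq_add_closed:
  assumes "x \<in> carrier S" "y \<in> carrier S" shows "(\<lambda>k. x k \<oplus>\<^bsub>V k\<^esub> y k) \<in> carrier S"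
proof -
  obtain m where m: "\<And>k. m \<le> k \<Longrightarrow> \<phi> k (x k) = x (Suc k)" using seq_coherent[OF assms(1)] by blast
  obtain n where n: "\<And>k. n \<le> k \<Longrightarrow> \<phi> k (y k) = y (Suc k)" using seq_coherent[OF assms(2)] by blast
  show ?thesis
    by (rule seq_carrierI[of _ "max m n"]) (simp_all add: assms seq_closed \<phi>.add m n)
qed

lemma seq_smult_closed:
  assumes "x \<in> carrier S" shows "(\<lambda>k. c \<odot>\<^bsub>V k\<^esub> x k) \<in> carrier S"
proof -
  obtain m where m: "\<And>k. m \<le> k \<Longrightarrow> \<phi> k (x k) = x (Suc k)" using seq_coherent[OF assms(1)] by blast
  show ?thesis
    by (rule seq_carrierI[of _ m]) (simp_all add: assms seq_closed \<phi>.smult m)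
qed

lemma seq_star_closed:
  assumes "x \<in> carrier S" shows "(\<lambda>k. star (V k) (x k)) \<in> carrier S"
proof -
  obtain m where m: "\<And>k. m \<le> k \<Longrightarrow> \<phi> k (x k) = x (Suc k)" using seq_coherent[OF assms(1)] by blast
  show ?thesis
    by (rule seq_carrierI[of _ m]) (simp_all add: assms seq_closed V.star_closed \<phi>.star m)
qed

lemma seq_module: "complex_module S"
proof -
  have "abelian_group S"
  proof (rule abelian_groupI)
    fix x assume x: "x \<in> carrier S"
    have "(\<lambda>k. (-1) \<odot>\<^bsub>V k\<^esub> x k) \<oplus>\<^bsub>S\<^esub> x = \<zero>\<^bsub>S\<^esub>"
    proof -
      have "(-1) \<odot>\<^bsub>V k\<^esub> x k \<oplus>\<^bsub>V k\<^esub> x k = \<zero>\<^bsub>V k\<^esub>" for k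
        by (rule V.coordinates[OF seq_closed[OF x, of k] seq_closed[OF x, of k] seq_closed[OF x, of k]]) simp
      then show ?thesis by (simp add: seq_simps)
    qed
    then show "\<exists>y\<in>carrier S. y \<oplus>\<^bsub>S\<^esub> x = \<zero>\<^bsub>S\<^esub>" using seq_smult_closed[OF x] by (rule bexI)
  qed (simp_all add: seq_simps seq_closed seq_zero_closed seq_add_closed V.M.a_ac)
  moreover have "module_axioms (ring_of_type_algebra :: complex ring) S"
    by (rule module_axioms.intro)
       (simp_all add: seq_simps seq_closed seq_smult_closed ring_of_type_algebra_def
         V.smult_add_left V.smult_add_right V.smult_smult V.smult_1)
  ultimately show ?thesis
    by (intro complex_module.intro module.intro cring_from_type_algebra)
qed

lemma null_seqsI:
  "x \<in> carrier S \<Longrightarrow> (\<And>k. m \<le> k \<Longrightarrow> x k = \<zero>\<^bsub>V k\<^esub>) \<Longrightarrow> x \<in> Z"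
  unfolding null_seqs_def by blast

lemma null_seqsE:
  assumes "x \<in> Z" obtains m where "\<And>k. m \<le> k \<Longrightarrow> x k = \<zero>\<^bsub>V k\<^esub>"
  using assms unfolding null_seqs_def by blast

lemma null_seqs_carrier: "x \<in> Z \<Longrightarrow> x \<in> carrier S"
  by (simp add: null_seqs_def)

lemma null_seqs_subspace: "complex_subspace S Z"
proof -
  interpret complex_module S by (rule seq_module)
  show ?thesis
  proof
    show "Z \<subseteq> carrier S" using null_seqs_carrier by (rule subsetI)
    show "\<zero>\<^bsub>S\<^esub> \<in> Z"
      by (rule null_seqsI) (simp_all add: seq_simps seq_zero_closed)
  next
    fix x y assume x: "x \<in> Z" and y: "y \<in> Z"
    obtain m where m: "\<And>k. m \<le> k \<Longrightarrow> x k = \<zero>\<^bsub>V k\<^esub>" using null_seqsE[OF x] by blast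
    obtain n where n: "\<And>k. n \<le> k \<Longrightarrow> y k = \<zero>\<^bsub>V k\<^esub>" using null_seqsE[OF y] by blast
    show "x \<oplus>\<^bsub>S\<^esub> y \<in> Z"
      by (rule null_seqsI[of _ "max m n"])
         (simp_all add: seq_simps seq_add_closed null_seqs_carrier x y m n)
  next
    fix x c assume x: "x \<in> Z"
    obtain m where m: "\<And>k. m \<le> k \<Longrightarrow> x k = \<zero>\<^bsub>V k\<^esub>" using null_seqsE[OF x] by blast
    show "c \<odot>\<^bsub>S\<^esub> x \<in> Z"
      by (rule null_seqsI[of _ m])
         (simp_all add: seq_simps seq_smult_closed null_seqs_carrier x m V.smult_zero)
  qed
qed

end

sublocale aou_system \<subseteq> S: complex_subspace "seq_space V \<phi>" "null_seqs V \<phi>"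
  by (rule null_seqs_subspace)

context aou_system
begin

lemma seq_minus:
  assumes "x \<in> carrier S" "y \<in> carrier S" shows "x \<ominus>\<^bsub>S\<^esub> y = (\<lambda>k. x k \<ominus>\<^bsub>V k\<^esub> y k)"
proof -
  have "\<ominus>\<^bsub>S\<^esub> y = (\<lambda>k. \<ominus>\<^bsub>V k\<^esub> y k)"
    using assms by (simp add: S.minus_eq_smult seq_simps V.minus_eq_smult seq_closed)
  then show ?thesis by (simp add: S.minus_eq V.minus_eq seq_simps)
qed

lemma minus_zero_iff:
  assumes x: "x \<in> carrier (V k)" and y: "y \<in> carrier (V k)"
  shows "x \<ominus>\<^bsub>V k\<^esub> y = \<zero>\<^bsub>V k\<^esub> \<longleftrightarrow> x = y"
proof
  assume *: "x \<ominus>\<^bsub>V k\<^esub> y = \<zero>\<^bsub>V k\<^esub>"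
  have "(x \<ominus>\<^bsub>V k\<^esub> y) \<oplus>\<^bsub>V k\<^esub> y = x" by (rule V.coordinates[OF x y y]) simp
  then show "x = y" using y by (simp add: *)
next
  have "y \<ominus>\<^bsub>V k\<^esub> y = \<zero>\<^bsub>V k\<^esub>" by (rule V.coordinates[OF y y y]) simp
  then show "x = y \<Longrightarrow> x \<ominus>\<^bsub>V k\<^esub> y = \<zero>\<^bsub>V k\<^esub>" by simp
qed

text \<open>Classes modulo null sequences are germs at infinity.\<close>

lemma seq_coset_eq_iff:
  assumes "x \<in> carrier S" "y \<in> carrier S"
  shows "Z +>\<^bsub>S\<^esub> x = Z +>\<^bsub>S\<^esub> y \<longleftrightarrow> (\<exists>m. \<forall>k\<ge>m. x k = y k)"
proof -
  have c: "x \<ominus>\<^bsub>S\<^esub> y \<in> carrier S" using assms by (rule S.M.minus_closed)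
  have "Z +>\<^bsub>S\<^esub> x = Z +>\<^bsub>S\<^esub> y \<longleftrightarrow> x \<ominus>\<^bsub>S\<^esub> y \<in> Z" by (rule S.coset_eq_iff[OF assms])
  also have "\<dots> \<longleftrightarrow> (\<exists>m. \<forall>k\<ge>m. (x \<ominus>\<^bsub>S\<^esub> y) k = \<zero>\<^bsub>V k\<^esub>)"
    by (simp only: null_seqs_def mem_Collect_eq c simp_thms)
  also have "\<dots> \<longleftrightarrow> (\<exists>m. \<forall>k\<ge>m. x k = y k)"
    by (simp only: seq_minus[OF assms] minus_zero_iff[OF seq_closed[OF assms(1)] seq_closed[OF assms(2)]])
  finally show ?thesis .
qed

section \<open>The algebraic colimit as an order unit space\<close>

definition tail :: "nat \<Rightarrow> 'a \<Rightarrow> nat \<Rightarrow> 'a" where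
  "tail k x = (\<lambda>i. if i < k then \<zero>\<^bsub>V i\<^esub> else phi_to \<phi> k i x)"

lemma phi_ddot_tail: "phi_ddot V \<phi> k x = Z +>\<^bsub>S\<^esub> tail k x"
  by (simp add: phi_ddot_def tail_def)

lemma tail_closed: "x \<in> carrier (V k) \<Longrightarrow> tail k x \<in> carrier S"
  by (rule seq_carrierI[of _ k]) (simp_all add: tail_def phi_to_closed phi_to_Suc)

text \<open>Agreement at one common stage propagates to all later stages, so equality of germs is
  the usual equality in a sequential colimit. Most facts below are proved by moving representatives
  to such a stage.\<close>

lemma phi_ddot_eq_iff:
  assumes x: "x \<in> carrier (V k)" and y: "y \<in> carrier (V l)"
  shows "phi_ddot V \<phi> k x = phi_ddot V \<phi> l y \<longleftrightarrow>
    (\<exists>m. k \<le> m \<and> l \<le> m \<and> phi_to \<phi> k m x = phi_to \<phi> l m y)" (is "?L \<longleftrightarrow> ?R")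
proof -
  have "?L \<longleftrightarrow> (\<exists>m. \<forall>i\<ge>m. tail k x i = tail l y i)"
    unfolding phi_ddot_tail by (rule seq_coset_eq_iff[OF tail_closed[OF x] tail_closed[OF y]])
  also have "\<dots> \<longleftrightarrow> ?R"
  proof
    assume "\<exists>m. \<forall>i\<ge>m. tail k x i = tail l y i"
    then obtain m where "\<forall>i\<ge>m. tail k x i = tail l y i" ..
    \<comment> \<open>Beyond \<open>max k l\<close> neither sequence shows its padding by
      zeros.\<close>
    then have "tail k x (max m (max k l)) = tail l y (max m (max k l))" by simp
    then show ?R by (intro exI[of _ "max m (max k l)"]) (simp add: tail_def le_max_iff_disj)
  next
    assume ?R
    then obtain m where m: "k \<le> m" "l \<le> m" "phi_to \<phi> k m x = phi_to \<phi> l m y" by (elim exE conjE)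
    have "tail k x i = tail l y i" if i: "m \<le> i" for i
      using m i phi_to_trans[OF m(1) i, of \<phi> x] phi_to_trans[OF m(2) i, of \<phi> y]
      by (simp add: tail_def)
    then show "\<exists>m. \<forall>i\<ge>m. tail k x i = tail l y i" by (intro exI[of _ m]) simp
  qed
  finally show ?thesis .
qed

text \<open>From the threshold \<open>m\<close> on, the sequence is the orbit of \<open>x m\<close>.
  Hence every class comes from a single stage.\<close>

lemma seq_coset_eq_phi_ddot:
  assumes x: "x \<in> carrier S" and m: "\<And>k. m \<le> k \<Longrightarrow> \<phi> k (x k) = x (Suc k)"
  shows "Z +>\<^bsub>S\<^esub> x = phi_ddot V \<phi> m (x m)"
proof -
  have "phi_to \<phi> m i (x m) = x i" if "m \<le> i" for i
    using that by (induction i rule: dec_induct) (simp_all add: phi_to_Suc m)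
  then have "\<forall>i\<ge>m. x i = tail m (x m) i" by (simp add: tail_def)
  then show ?thesis
    unfolding phi_ddot_tail using seq_coset_eq_iff[OF x tail_closed[OF seq_closed[OF x]]] by blast
qed

lemma phi_ddot_surj:
  assumes "C \<in> carrier W" obtains k x where "x \<in> carrier (V k)" "C = phi_ddot V \<phi> k x"
proof -
  obtain y where y: "y \<in> carrier S" "C = Z +>\<^bsub>S\<^esub> y"
    using assms by (auto simp: V_ddot_def S.quotient_carrier)
  obtain m where m: "\<And>k. m \<le> k \<Longrightarrow> \<phi> k (y k) = y (Suc k)" using seq_coherent[OF y(1)] by blast
  show thesis using that[OF seq_closed[OF y(1)]] seq_coset_eq_phi_ddot[OF y(1) m] y(2) by simp
qed

lemma phi_ddot_phi_to:
  assumes "x \<in> carrier (V k)" "k \<le> l"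
  shows "phi_ddot V \<phi> l (phi_to \<phi> k l x) = phi_ddot V \<phi> k x"
  using assms by (subst phi_ddot_eq_iff) (auto simp: phi_to_closed intro!: exI[of _ l])

lemma phi_ddot_phi: "x \<in> carrier (V k) \<Longrightarrow> phi_ddot V \<phi> (Suc k) (\<phi> k x) = phi_ddot V \<phi> k x"
  using phi_ddot_phi_to[of x k "Suc k"] by (simp add: phi_to_Suc)

lemma phi_ddot_closed: "x \<in> carrier (V k) \<Longrightarrow> phi_ddot V \<phi> k x \<in> carrier W"
  by (simp add: V_ddot_def S.quotient_carrier phi_ddot_tail tail_closed)

lemma phi_ddot_add:
  assumes "x \<in> carrier (V k)" "y \<in> carrier (V k)"
  shows "phi_ddot V \<phi> k (x \<oplus>\<^bsub>V k\<^esub> y) = phi_ddot V \<phi> k x \<oplus>\<^bsub>W\<^esub> phi_ddot V \<phi> k y"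
proof -
  have "tail k (x \<oplus>\<^bsub>V k\<^esub> y) = tail k x \<oplus>\<^bsub>S\<^esub> tail k y"
    using assms by (simp add: tail_def seq_simps phi_to_add fun_eq_iff)
  then show ?thesis
    using assms by (simp add: V_ddot_def S.quotient_add phi_ddot_tail tail_closed)
qed

lemma phi_ddot_smult:
  assumes "x \<in> carrier (V k)"
  shows "phi_ddot V \<phi> k (c \<odot>\<^bsub>V k\<^esub> x) = c \<odot>\<^bsub>W\<^esub> phi_ddot V \<phi> k x"
proof -
  have "tail k (c \<odot>\<^bsub>V k\<^esub> x) = c \<odot>\<^bsub>S\<^esub> tail k x"
    using assms by (simp add: tail_def seq_simps phi_to_smult V.smult_zero fun_eq_iff)
  then show ?thesis
    using assms by (simp add: V_ddot_def S.quotient_smult phi_ddot_tail tail_closed)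
qed

text \<open>The description by \<open>THE\<close> is unambiguous: representatives that agree at a
  later stage have stars that agree there, since connecting maps commute with the
  involution.\<close>

lemma star_phi_ddot:
  assumes x: "x \<in> carrier (V k)"
  shows "star W (phi_ddot V \<phi> k x) = phi_ddot V \<phi> k (star (V k) x)"
proof -
  have "phi_ddot V \<phi> l (star (V l) y) = phi_ddot V \<phi> k (star (V k) x)"
    if y: "y \<in> carrier (V l)" and eq: "phi_ddot V \<phi> k x = phi_ddot V \<phi> l y" for l y
  proof -
    obtain m where m: "k \<le> m" "l \<le> m" "phi_to \<phi> k m x = phi_to \<phi> l m y"
      using eq phi_ddot_eq_iff[OF x y] by auto
    then have "phi_to \<phi> l m (star (V l) y) = phi_to \<phi> k m (star (V k) x)"
      using x y by (simp add: phi_to_star)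
    then show ?thesis
      using m phi_ddot_eq_iff[OF V.star_closed[OF y] V.star_closed[OF x]] by blast
  qed
  then have "(THE D. \<exists>l. \<exists>y\<in>carrier (V l). phi_ddot V \<phi> k x = phi_ddot V \<phi> l y \<and>
      D = phi_ddot V \<phi> l (star (V l) y)) = phi_ddot V \<phi> k (star (V k) x)"
    by (intro the_equality) (use x in blast)+
  then show ?thesis by (simp add: V_ddot_def quotient_space_def)
qed

lemma ddot_star_vector_space: "star_vector_space W"
  unfolding V_ddot_def
\<comment> \<open>The pointwise involution serves as the lift; it keeps sequences eventually
  coherent.\<close>
proof (rule S.quotient_star_vector_space[where s = "\<lambda>x k. star (V k) (x k)"])
  fix x assume x: "x \<in> carrier S"
  obtain m where m: "\<And>k. m \<le> k \<Longrightarrow> \<phi> k (x k) = x (Suc k)" using seq_coherent[OF x] by blast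
  have "Z +>\<^bsub>S\<^esub> (\<lambda>k. star (V k) (x k)) = phi_ddot V \<phi> m (star (V m) (x m))"
    by (rule seq_coset_eq_phi_ddot[OF seq_star_closed[OF x]])
       (simp add: \<phi>.star seq_closed[OF x] m)
  also have "\<dots> = star W (Z +>\<^bsub>S\<^esub> x)"
    by (simp add: seq_coset_eq_phi_ddot[OF x m] star_phi_ddot seq_closed[OF x])
  finally show "(THE D. \<exists>k. \<exists>y\<in>carrier (V k). Z +>\<^bsub>S\<^esub> x = phi_ddot V \<phi> k y \<and>
      D = phi_ddot V \<phi> k (star (V k) y)) = Z +>\<^bsub>S\<^esub> (\<lambda>k. star (V k) (x k))"
    by (simp add: V_ddot_def quotient_space_def)
qed (simp_all add: seq_simps seq_star_closed seq_closed V.star_star V.star_add V.star_smult)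

end

sublocale aou_system \<subseteq> W: star_vector_space "V_ddot V \<phi>"
  by (rule ddot_star_vector_space)

context aou_system
begin

lemma ounit_ddot: "phi_ddot V \<phi> k (ounit (V k)) = ounit W"
  using phi_ddot_phi_to[OF V.ounit_carrier, of 0 k]
  by (simp add: phi_to_unit V_ddot_def quotient_space_def)

lemma ddot_pos: "pos W =
    {phi_ddot V \<phi> k x | k x. x \<in> carrier (V k) \<and> (\<exists>m\<ge>k. phi_to \<phi> k m x \<in> pos (V m))}"
  by (simp add: V_ddot_def quotient_space_def)

lemma phi_ddot_pos:
  assumes x: "x \<in> pos (V k)" shows "phi_ddot V \<phi> k x \<in> pos W"
proof -
  have "\<exists>m\<ge>k. phi_to \<phi> k m x \<in> pos (V m)" using x by (intro exI[of _ k]) simp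
  with V.pos_carrier[OF x] show ?thesis unfolding ddot_pos by blast
qed

text \<open>The representative is replaced by its image at the stage where it has become
  positive.\<close>

lemma pos_ddotE:
  assumes "C \<in> pos W" obtains k x where "x \<in> pos (V k)" "C = phi_ddot V \<phi> k x"
proof -
  obtain k x m where "C = phi_ddot V \<phi> k x" "x \<in> carrier (V k)" "k \<le> m" "phi_to \<phi> k m x \<in> pos (V m)"
    using assms unfolding ddot_pos by blast
  then show thesis using that[of "phi_to \<phi> k m x" m] by (simp add: phi_ddot_phi_to)
qed

text \<open>If the class of \<open>x\<close> is hermitian, then \<open>x\<close> and its star agree
  at some later stage; the image of \<open>x\<close> there is a hermitian representative.\<close>

lemma hermitian_ddotE:
  assumes C: "C \<in> hermitian W" obtains k x where "x \<in> hermitian (V k)" "C = phi_ddot V \<phi> k x"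
proof -
  obtain k x where x: "x \<in> carrier (V k)" "C = phi_ddot V \<phi> k x"
    using phi_ddot_surj[OF W.hermitian_carrier[OF C]] .
  have "phi_ddot V \<phi> k (star (V k) x) = phi_ddot V \<phi> k x"
    using C x by (simp add: hermitian_def star_phi_ddot)
  then obtain m where m: "k \<le> m" "phi_to \<phi> k m (star (V k) x) = phi_to \<phi> k m x"
    using phi_ddot_eq_iff[OF V.star_closed[OF x(1)] x(1)] by auto
  then have "phi_to \<phi> k m x \<in> hermitian (V m)"
    using x by (simp add: hermitian_def phi_to_star phi_to_closed)
  then show thesis using that[of "phi_to \<phi> k m x" m] x m by (simp add: phi_ddot_phi_to)
qed

lemma phi_ddot_hermitian: "x \<in> hermitian (V k) \<Longrightarrow> phi_ddot V \<phi> k x \<in> hermitian W"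
  by (simp add: hermitian_def star_phi_ddot phi_ddot_closed)

lemma phi_ddot_uminus:
  "x \<in> carrier (V k) \<Longrightarrow> phi_ddot V \<phi> k (\<ominus>\<^bsub>V k\<^esub> x) = \<ominus>\<^bsub>W\<^esub> phi_ddot V \<phi> k x"
  by (simp add: V.minus_eq_smult W.minus_eq_smult phi_ddot_smult phi_ddot_closed)

lemma phi_ddot_minus:
  "x \<in> carrier (V k) \<Longrightarrow> y \<in> carrier (V k) \<Longrightarrow>
    phi_ddot V \<phi> k (x \<ominus>\<^bsub>V k\<^esub> y) = phi_ddot V \<phi> k x \<ominus>\<^bsub>W\<^esub> phi_ddot V \<phi> k y"
  by (simp add: V.minus_eq W.minus_eq phi_ddot_add phi_ddot_uminus)

lemma phi_ddot_zero: "phi_ddot V \<phi> k \<zero>\<^bsub>V k\<^esub> = \<zero>\<^bsub>W\<^esub>"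
  using phi_ddot_smult[of "\<zero>\<^bsub>V k\<^esub>" k 0]
  by (simp add: V.smult_zero W.smult_0 phi_ddot_closed)

text \<open>The relation \<open>C = - D\<close> already holds between images at some stage
  \<open>m\<close>. Both images are positive there, so properness of the cone of \<open>V m\<close>
  applies.\<close>

lemma ddot_pos_antisym:
  assumes C: "C \<in> pos W" and D: "D \<in> pos W" and CD: "C = \<ominus>\<^bsub>W\<^esub> D" shows "C = \<zero>\<^bsub>W\<^esub>"
proof -
  obtain k x where x: "x \<in> pos (V k)" "C = phi_ddot V \<phi> k x" by (rule pos_ddotE[OF C])
  obtain l y where y: "y \<in> pos (V l)" "D = phi_ddot V \<phi> l y" by (rule pos_ddotE[OF D])
  note xc = V.pos_carrier[OF x(1)] and yc = V.pos_carrier[OF y(1)]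
  have "phi_ddot V \<phi> k x = phi_ddot V \<phi> l (\<ominus>\<^bsub>V l\<^esub> y)"
    using CD x(2) y(2) yc by (simp add: phi_ddot_uminus)
  then obtain m where m: "k \<le> m" "l \<le> m" "phi_to \<phi> k m x = phi_to \<phi> l m (\<ominus>\<^bsub>V l\<^esub> y)"
    using phi_ddot_eq_iff[OF xc V.M.a_inv_closed[OF yc]] by auto
  have mx: "phi_to \<phi> k m x = \<ominus>\<^bsub>V m\<^esub> phi_to \<phi> l m y" using m yc by (simp add: phi_to_uminus)
  have "\<ominus>\<^bsub>V m\<^esub> phi_to \<phi> k m x = phi_to \<phi> l m y"
    using mx m yc by (simp add: phi_to_closed)
  then have "\<ominus>\<^bsub>V m\<^esub> phi_to \<phi> k m x \<in> pos (V m)" using m y(1) by (simp add: phi_to_pos)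
  then have "phi_to \<phi> k m x = \<zero>\<^bsub>V m\<^esub>" by (rule V.pos_antisym[OF phi_to_pos[OF m(1) x(1)]])
  then show ?thesis using phi_ddot_phi_to[OF xc m(1)] x(2) by (simp add: phi_ddot_zero)
qed

lemma ddot_order_unit_space: "order_unit_space W"
proof
  show "pos W \<subseteq> hermitian W"
  proof
    fix C assume "C \<in> pos W"
    then obtain k x where x: "x \<in> pos (V k)" "C = phi_ddot V \<phi> k x" by (rule pos_ddotE)
    then show "C \<in> hermitian W" using V.pos_hermitian[of k] by (simp add: phi_ddot_hermitian subset_iff)
  qed
  show z: "\<zero>\<^bsub>W\<^esub> \<in> pos W" using phi_ddot_pos[OF V.pos_zero, of 0] by (simp add: phi_ddot_zero)
  show "C \<oplus>\<^bsub>W\<^esub> D \<in> pos W" if C: "C \<in> pos W" and D: "D \<in> pos W" for C D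
  proof -
    obtain k x where x: "x \<in> pos (V k)" "C = phi_ddot V \<phi> k x" by (rule pos_ddotE[OF C])
    obtain l y where y: "y \<in> pos (V l)" "D = phi_ddot V \<phi> l y" by (rule pos_ddotE[OF D])
    note xc = V.pos_carrier[OF x(1)] and yc = V.pos_carrier[OF y(1)]
    let ?m = "max k l"
    have "phi_to \<phi> k ?m x \<oplus>\<^bsub>V ?m\<^esub> phi_to \<phi> l ?m y \<in> pos (V ?m)"
      by (rule V.pos_add) (simp_all add: phi_to_pos x y)
    from phi_ddot_pos[OF this] show ?thesis
      using xc yc by (simp add: phi_ddot_add phi_to_closed phi_ddot_phi_to x y)
  qed
  show "complex_of_real r \<odot>\<^bsub>W\<^esub> C \<in> pos W" if r: "0 \<le> r" and C: "C \<in> pos W" for r C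
  proof -
    obtain k x where x: "x \<in> pos (V k)" "C = phi_ddot V \<phi> k x" by (rule pos_ddotE[OF C])
    show ?thesis
      using phi_ddot_pos[OF V.pos_smult[OF r x(1)]] V.pos_carrier[OF x(1)] x(2)
      by (simp add: phi_ddot_smult)
  qed
  show "pos W \<inter> {\<ominus>\<^bsub>W\<^esub> C |C. C \<in> pos W} = {\<zero>\<^bsub>W\<^esub>}"
  proof (rule equalityI; rule subsetI)
    fix C assume C: "C \<in> pos W \<inter> {\<ominus>\<^bsub>W\<^esub> C |C. C \<in> pos W}"
    then obtain D where D: "D \<in> pos W" "C = \<ominus>\<^bsub>W\<^esub> D" by blast
    show "C \<in> {\<zero>\<^bsub>W\<^esub>}" using ddot_pos_antisym[OF _ D] C by simp
  next
    fix C assume "C \<in> {\<zero>\<^bsub>W\<^esub>}"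
    then have "C = \<zero>\<^bsub>W\<^esub>" by (rule singletonD)
    moreover have "\<zero>\<^bsub>W\<^esub> = \<ominus>\<^bsub>W\<^esub> \<zero>\<^bsub>W\<^esub>"
      by (rule sym, rule trans[OF W.minus_eq_smult[OF W.M.zero_closed] W.smult_zero])
    ultimately show "C \<in> pos W \<inter> {\<ominus>\<^bsub>W\<^esub> C |C. C \<in> pos W}" using z by blast
  qed
  show "ounit W \<in> pos W" using phi_ddot_pos[OF V.ounit_pos, of 0] by (simp add: ounit_ddot)
  show "\<exists>r>0. complex_of_real r \<odot>\<^bsub>W\<^esub> ounit W \<ominus>\<^bsub>W\<^esub> C \<in> pos W" if C: "C \<in> hermitian W" for C
  proof -
    obtain k x where x: "x \<in> hermitian (V k)" "C = phi_ddot V \<phi> k x" by (rule hermitian_ddotE[OF C])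
    obtain r where r: "0 < r" "complex_of_real r \<odot>\<^bsub>V k\<^esub> ounit (V k) \<ominus>\<^bsub>V k\<^esub> x \<in> pos (V k)"
      using V.order_unit[OF x(1)] by (elim exE conjE)
    show ?thesis
      using phi_ddot_pos[OF r(2)] V.hermitian_carrier[OF x(1)] r(1) x(2)
      by (intro exI[of _ r]) (simp add: phi_ddot_minus phi_ddot_smult ounit_ddot)
  qed
qed

text \<open>The value at a class is well defined because representatives agree at a later stage, and
  compatibility identifies the value there with the original one. Additivity is checked after moving
  both classes to a common stage.\<close>

lemma ddot_universal:
  fixes B :: "('c, 'n) star_ou_space_scheme"
  assumes \<beta>: "\<And>k. aou_hom (V k) B (\<beta> k)"
    and compat: "\<And>k x. x \<in> carrier (V k) \<Longrightarrow> \<beta> (Suc k) (\<phi> k x) = \<beta> k x"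
  obtains \<psi> where "aou_hom W B \<psi>" "\<And>k x. x \<in> carrier (V k) \<Longrightarrow> \<psi> (phi_ddot V \<phi> k x) = \<beta> k x"
proof
  have \<beta>_to: "\<beta> m (phi_to \<phi> k m x) = \<beta> k x" if "k \<le> m" "x \<in> carrier (V k)" for k m x
    using that by (induction m rule: dec_induct) (simp_all add: phi_to_Suc compat phi_to_closed)
  define \<psi> where
    "\<psi> C = (THE b. \<exists>k. \<exists>x\<in>carrier (V k). C = phi_ddot V \<phi> k x \<and> b = \<beta> k x)" for C
  show \<psi>: "\<psi> (phi_ddot V \<phi> k x) = \<beta> k x" if x: "x \<in> carrier (V k)" for k x
    unfolding \<psi>_def
  proof (rule the_equality)
    show "\<exists>l. \<exists>y\<in>carrier (V l). phi_ddot V \<phi> k x = phi_ddot V \<phi> l y \<and> \<beta> k x = \<beta> l y"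
      using x by blast
    fix b assume "\<exists>l. \<exists>y\<in>carrier (V l). phi_ddot V \<phi> k x = phi_ddot V \<phi> l y \<and> b = \<beta> l y"
    then obtain l y where y: "y \<in> carrier (V l)" "phi_ddot V \<phi> k x = phi_ddot V \<phi> l y" "b = \<beta> l y"
      by blast
    then obtain m where "k \<le> m" "l \<le> m" "phi_to \<phi> k m x = phi_to \<phi> l m y"
      using phi_ddot_eq_iff[OF x y(1)] by auto
    then show "b = \<beta> k x" using \<beta>_to[of k m x] \<beta>_to[of l m y] x y by simp
  qed
  have add: "\<psi> (C \<oplus>\<^bsub>W\<^esub> D) = \<psi> C \<oplus>\<^bsub>B\<^esub> \<psi> D" if C: "C \<in> carrier W" and D: "D \<in> carrier W" for C D
  proof -
    obtain k x where x: "x \<in> carrier (V k)" "C = phi_ddot V \<phi> k x" by (rule phi_ddot_surj[OF C])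
    obtain l y where y: "y \<in> carrier (V l)" "D = phi_ddot V \<phi> l y" by (rule phi_ddot_surj[OF D])
    let ?m = "max k l"
    have x': "phi_to \<phi> k ?m x \<in> carrier (V ?m)" "C = phi_ddot V \<phi> ?m (phi_to \<phi> k ?m x)"
      and y': "phi_to \<phi> l ?m y \<in> carrier (V ?m)" "D = phi_ddot V \<phi> ?m (phi_to \<phi> l ?m y)"
      using x y by (simp_all add: phi_to_closed phi_ddot_phi_to)
    have "\<psi> (C \<oplus>\<^bsub>W\<^esub> D) = \<beta> ?m (phi_to \<phi> k ?m x \<oplus>\<^bsub>V ?m\<^esub> phi_to \<phi> l ?m y)"
      unfolding x'(2) y'(2) phi_ddot_add[OF x'(1) y'(1), symmetric]
      by (rule \<psi>[OF V.M.a_closed[OF x'(1) y'(1)]])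
    also have "\<dots> = \<beta> ?m (phi_to \<phi> k ?m x) \<oplus>\<^bsub>B\<^esub> \<beta> ?m (phi_to \<phi> l ?m y)"
      using \<beta>[of ?m] x'(1) y'(1) by (simp add: aou_hom_def)
    also have "\<dots> = \<psi> C \<oplus>\<^bsub>B\<^esub> \<psi> D" using x y by (simp add: \<psi> \<beta>_to)
    finally show ?thesis .
  qed
  show "aou_hom W B \<psi>"
    unfolding aou_hom_def
  proof (intro conjI ballI allI funcsetI subsetI)
    fix C assume "C \<in> carrier W"
    then obtain k x where x: "x \<in> carrier (V k)" "C = phi_ddot V \<phi> k x" by (rule phi_ddot_surj)
    then show "\<psi> C \<in> carrier B" using \<beta>[of k] by (auto simp: \<psi> aou_hom_def)
    show "\<psi> (c \<odot>\<^bsub>W\<^esub> C) = c \<odot>\<^bsub>B\<^esub> \<psi> C" for c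
      using \<beta>[of k] x by (simp add: \<psi> phi_ddot_smult[symmetric] aou_hom_def)
  next
    fix b assume "b \<in> \<psi> ` pos W"
    then obtain C where C: "C \<in> pos W" "b = \<psi> C" by blast
    obtain k x where x: "x \<in> pos (V k)" "C = phi_ddot V \<phi> k x" by (rule pos_ddotE[OF C(1)])
    then show "b \<in> pos B" using \<beta>[of k] C(2) by (auto simp: \<psi> V.pos_carrier aou_hom_def)
  next
    show "\<psi> (ounit W) = ounit B"
      using \<psi>[OF V.ounit_carrier, of 0] \<beta>[of 0] by (simp add: ounit_ddot aou_hom_def)
  qed (rule add)
qed

end

section \<open>The Archimedeanisation of the colimit\<close>

sublocale aou_system \<subseteq> W: order_unit_space "V_ddot V \<phi>"
  by (rule ddot_order_unit_space)

sublocale aou_system \<subseteq> N: complex_subspace "V_ddot V \<phi>" "state_null (V_ddot V \<phi>)"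
  by (rule W.state_null_subspace)

context aou_system
begin

abbreviation "N \<equiv> state_null W"

definition V_inf_star where "V_inf_star C = (\<Union>D\<in>C. N +>\<^bsub>W\<^esub> star W D)"

text \<open>The involution preserves \<open>N\<close>, so the union defining
  \<open>V_inf_star\<close> runs over equal cosets.\<close>

lemma V_inf_star_coset:
  assumes C: "C \<in> carrier W" shows "V_inf_star (N +>\<^bsub>W\<^esub> C) = N +>\<^bsub>W\<^esub> star W C"
proof -
  have "N +>\<^bsub>W\<^esub> star W D = N +>\<^bsub>W\<^esub> star W C" if D: "D \<in> N +>\<^bsub>W\<^esub> C" for D
  proof -
    obtain n where n: "n \<in> N" "D = n \<oplus>\<^bsub>W\<^esub> C" using D by (auto simp: a_r_coset_def')
    note nc = N.subspace_carrier[OF n(1)]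
    have "star W D \<ominus>\<^bsub>W\<^esub> star W C = star W n"
      unfolding n(2) W.star_add[OF nc C]
      by (rule W.coordinates[OF W.star_closed[OF nc] W.star_closed[OF C] W.star_closed[OF C]]) simp
    then have "star W D \<ominus>\<^bsub>W\<^esub> star W C \<in> N" using W.state_null_star[OF n(1)] by simp
    moreover have "star W D \<in> carrier W" using n nc C by (simp add: W.star_closed)
    ultimately show ?thesis using N.coset_eq_iff[OF _ W.star_closed[OF C]] by simp
  qed
  then have "V_inf_star (N +>\<^bsub>W\<^esub> C) = (\<Union>D\<in>N +>\<^bsub>W\<^esub> C. N +>\<^bsub>W\<^esub> star W C)"
    unfolding V_inf_star_def by (intro SUP_cong refl)
  moreover have "N +>\<^bsub>W\<^esub> C \<noteq> {}" using N.coset.a_rcos_self[OF C] by (metis empty_iff)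
  ultimately show ?thesis by simp
qed

text \<open>Brings the construction into the shape of the general theorems. Its cone is indexed by
  hermitian vectors of single stages, which reach every hermitian class by
  \<open>hermitian_ddotE\<close>, and its condition has the summands in the opposite order.\<close>

lemma V_inf_eq:
  "V_inf V \<phi> =
    quotient_space W N V_inf_star ((\<lambda>C. N +>\<^bsub>W\<^esub> C) ` W.arch_cone) (N +>\<^bsub>W\<^esub> ounit W)"
proof -
  have "{quot_map V \<phi> (phi_ddot V \<phi> k x) | k x. x \<in> hermitian (V k) \<and>
          (\<forall>r>0. phi_ddot V \<phi> k x \<oplus>\<^bsub>W\<^esub> (complex_of_real r \<odot>\<^bsub>W\<^esub> ounit W) \<in> pos W)}
      = (\<lambda>C. N +>\<^bsub>W\<^esub> C) ` W.arch_cone" (is "?P = _")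
  proof (rule equalityI; rule subsetI)
    fix D assume "D \<in> ?P"
    then obtain k x where x: "D = quot_map V \<phi> (phi_ddot V \<phi> k x)" "x \<in> hermitian (V k)"
      "\<forall>r>0. phi_ddot V \<phi> k x \<oplus>\<^bsub>W\<^esub> (complex_of_real r \<odot>\<^bsub>W\<^esub> ounit W) \<in> pos W" by blast
    have "phi_ddot V \<phi> k x \<in> W.arch_cone"
      using x phi_ddot_closed[OF V.hermitian_carrier[OF x(2)]]
      by (simp add: W.arch_cone_def phi_ddot_hermitian W.M.a_comm[of _ "phi_ddot V \<phi> k x"])
    then show "D \<in> (\<lambda>C. N +>\<^bsub>W\<^esub> C) ` W.arch_cone" using x(1) by (simp add: quot_map_def)
  next
    fix D assume "D \<in> (\<lambda>C. N +>\<^bsub>W\<^esub> C) ` W.arch_cone"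
    then obtain C where C: "C \<in> W.arch_cone" "D = N +>\<^bsub>W\<^esub> C" by blast
    then have H: "C \<in> hermitian W" by (simp add: W.arch_cone_def)
    obtain k x where x: "x \<in> hermitian (V k)" "C = phi_ddot V \<phi> k x" by (rule hermitian_ddotE[OF H])
    have "\<forall>r>0. C \<oplus>\<^bsub>W\<^esub> (complex_of_real r \<odot>\<^bsub>W\<^esub> ounit W) \<in> pos W"
      using C(1) W.hermitian_carrier[OF H] by (simp add: W.arch_cone_def W.M.a_comm[of C])
    then show "D \<in> ?P" using x C(2) unfolding quot_map_def by blast
  qed
  moreover have "(\<lambda>C. \<Union>D\<in>C. quot_map V \<phi> (star W D)) = V_inf_star"
    by (simp add: V_inf_star_def quot_map_def fun_eq_iff)
  ultimately show ?thesis by (simp add: V_inf_def quot_map_def)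
qed

lemma V_inf_quotient:
  shows V_inf_carrier: "carrier (V_inf V \<phi>) = (\<lambda>C. N +>\<^bsub>W\<^esub> C) ` carrier W"
    and V_inf_add: "C \<in> carrier W \<Longrightarrow> D \<in> carrier W \<Longrightarrow>
      (N +>\<^bsub>W\<^esub> C) \<oplus>\<^bsub>V_inf V \<phi>\<^esub> (N +>\<^bsub>W\<^esub> D) = N +>\<^bsub>W\<^esub> (C \<oplus>\<^bsub>W\<^esub> D)"
    and V_inf_smult: "C \<in> carrier W \<Longrightarrow> c \<odot>\<^bsub>V_inf V \<phi>\<^esub> (N +>\<^bsub>W\<^esub> C) = N +>\<^bsub>W\<^esub> (c \<odot>\<^bsub>W\<^esub> C)"
    and V_inf_pos: "pos (V_inf V \<phi>) = (\<lambda>C. N +>\<^bsub>W\<^esub> C) ` W.arch_cone"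
    and V_inf_ounit: "ounit (V_inf V \<phi>) = N +>\<^bsub>W\<^esub> ounit W"
proof -
  show "carrier (V_inf V \<phi>) = (\<lambda>C. N +>\<^bsub>W\<^esub> C) ` carrier W"
    unfolding V_inf_eq by (rule N.quotient_carrier)
  show "C \<in> carrier W \<Longrightarrow> D \<in> carrier W \<Longrightarrow>
      (N +>\<^bsub>W\<^esub> C) \<oplus>\<^bsub>V_inf V \<phi>\<^esub> (N +>\<^bsub>W\<^esub> D) = N +>\<^bsub>W\<^esub> (C \<oplus>\<^bsub>W\<^esub> D)"
    unfolding V_inf_eq by (rule N.quotient_add)
  show "C \<in> carrier W \<Longrightarrow> c \<odot>\<^bsub>V_inf V \<phi>\<^esub> (N +>\<^bsub>W\<^esub> C) = N +>\<^bsub>W\<^esub> (c \<odot>\<^bsub>W\<^esub> C)"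
    unfolding V_inf_eq by (rule N.quotient_smult)
  show "pos (V_inf V \<phi>) = (\<lambda>C. N +>\<^bsub>W\<^esub> C) ` W.arch_cone" "ounit (V_inf V \<phi>) = N +>\<^bsub>W\<^esub> ounit W"
    unfolding V_inf_eq by (simp_all add: quotient_space_def)
qed

lemma V_inf_aou_space: "aou_space (V_inf V \<phi>)"
  unfolding V_inf_eq by (rule W.archimedeanisation_aou_space[OF V_inf_star_coset refl])

lemma phi_inf_eq: "phi_inf V \<phi> k x = N +>\<^bsub>W\<^esub> phi_ddot V \<phi> k x"
  by (simp add: phi_inf_def quot_map_def)

lemma phi_inf_hom: "aou_hom (V k) (V_inf V \<phi>) (phi_inf V \<phi> k)"
  unfolding aou_hom_def
  using W.pos_arch_cone[OF phi_ddot_pos, of _ k]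
  by (simp add: phi_inf_eq V_inf_carrier V_inf_add V_inf_smult V_inf_pos V_inf_ounit
      phi_ddot_closed phi_ddot_add phi_ddot_smult ounit_ddot image_subset_iff)

lemma V_inf_universal:
  fixes B :: "'c star_ou_space"
  assumes "aou_space B"
    and \<beta>: "\<And>k. aou_hom (V k) B (\<beta> k)"
    and compat: "\<And>k x. x \<in> carrier (V k) \<Longrightarrow> \<beta> (Suc k) (\<phi> k x) = \<beta> k x"
  shows "\<exists>!\<mu>. \<mu> \<in> extensional (carrier (V_inf V \<phi>)) \<and> aou_hom (V_inf V \<phi>) B \<mu> \<and>
    (\<forall>k. \<forall>x\<in>carrier (V k). \<mu> (phi_inf V \<phi> k x) = \<beta> k x)"
proof -
  let ?L = "V_inf V \<phi>"
  interpret B: aou_space B by (rule assms(1))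
  interpret L: aou_space ?L by (rule V_inf_aou_space)
  obtain \<psi> where \<psi>: "aou_hom W B \<psi>" "\<And>k x. x \<in> carrier (V k) \<Longrightarrow> \<psi> (phi_ddot V \<phi> k x) = \<beta> k x"
    using ddot_universal[OF \<beta> compat] by metis
  interpret \<psi>: aou_morphism_to_aou W B \<psi> by unfold_locales (rule \<psi>(1))
  obtain g where g: "aou_hom ?L B g" "\<And>C. C \<in> carrier W \<Longrightarrow> g (N +>\<^bsub>W\<^esub> C) = \<psi> C"
    using \<psi>.archimedeanisation_universal[of V_inf_star, folded V_inf_eq] by blast
  show ?thesis
  proof (rule ex1I)
    \<comment> \<open>Restriction makes the mediating map extensional. It changes nothing on the
      cone, which lies in the carrier.\<close>
    have "aou_hom ?L B (restrict g (carrier ?L))"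
      using g(1) L.pos_carrier unfolding aou_hom_def
      by (simp add: image_subset_iff Pi_iff)
    then show "restrict g (carrier ?L) \<in> extensional (carrier ?L) \<and>
        aou_hom ?L B (restrict g (carrier ?L)) \<and>
        (\<forall>k. \<forall>x\<in>carrier (V k). restrict g (carrier ?L) (phi_inf V \<phi> k x) = \<beta> k x)"
      using \<psi>(2) by (simp add: phi_inf_eq V_inf_carrier phi_ddot_closed g(2))
  next
    fix \<mu> assume \<mu>: "\<mu> \<in> extensional (carrier ?L) \<and> aou_hom ?L B \<mu> \<and>
        (\<forall>k. \<forall>x\<in>carrier (V k). \<mu> (phi_inf V \<phi> k x) = \<beta> k x)"
    show "\<mu> = restrict g (carrier ?L)"
    proof (rule extensionalityI[of _ "carrier ?L"])
      \<comment> \<open>Uniqueness: the images of the stages cover the limit, so the prescribed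
        values determine the map on its carrier.\<close>
      fix D assume D: "D \<in> carrier ?L"
      then obtain C where C: "C \<in> carrier W" "D = N +>\<^bsub>W\<^esub> C" unfolding V_inf_carrier by blast
      obtain k x where x: "x \<in> carrier (V k)" "C = phi_ddot V \<phi> k x" by (rule phi_ddot_surj[OF C(1)])
      have "\<mu> D = \<beta> k x" using \<mu> x C(2) by (simp add: phi_inf_eq)
      also have "\<dots> = g D" using C x by (simp add: g(2) \<psi>(2))
      finally show "\<mu> D = restrict g (carrier ?L) D" using D by simp
    qed (use \<mu> in simp_all)
  qed
qed

end

theorem theorem3p14:
  fixes V :: "nat \<Rightarrow> 'a star_ou_space"
    and \<phi> :: "nat \<Rightarrow> 'a \<Rightarrow> 'a"
  assumes "\<And>k. aou_space (V k)"
    and "\<And>k. aou_hom (V k) (V (Suc k)) (\<phi> k)"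
  shows "is_inductive_limit TYPE('c) V \<phi> (V_inf V \<phi>) (phi_inf V \<phi>)"
proof -
  interpret aou_system V \<phi> by (rule aou_system.intro) (fact assms)+
  show ?thesis
    unfolding is_inductive_limit_def
  proof (intro conjI allI impI ballI)
    fix k x assume "x \<in> carrier (V k)"
    then show "phi_inf V \<phi> (Suc k) (\<phi> k x) = phi_inf V \<phi> k x"
      by (simp add: phi_inf_eq phi_ddot_phi)
  next
    fix B :: "'c star_ou_space" and \<beta> :: "nat \<Rightarrow> 'a \<Rightarrow> 'c"
    assume "aou_space B \<and> (\<forall>k. aou_hom (V k) B (\<beta> k)) \<and>
      (\<forall>k. \<forall>x\<in>carrier (V k). \<beta> (Suc k) (\<phi> k x) = \<beta> k x)"
    then show "\<exists>!\<mu>. \<mu> \<in> extensional (carrier (V_inf V \<phi>)) \<and> aou_hom (V_inf V \<phi>) B \<mu> \<and>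
        (\<forall>k. \<forall>x\<in>carrier (V k). \<mu> (phi_inf V \<phi> k x) = \<beta> k x)"
      by (intro V_inf_universal) simp_all
  qed (rule V_inf_aou_space phi_inf_hom)+
qed

end
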